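(* Suppose there are $\beta>1$ and constants $0<c_{\mathrm{eig}}\le C_{\mathrm{eig}}<\infty$ with $c_{\mathrm{eig}}j^{-\beta}\le\lambda_j\le C_{\mathrm{eig}}j^{-\beta}$ for all $j\ge1$. For fixed $r\ge1$, $s>1/\beta$, $R>0$ and $\sigma^2>0$, there exists a constant $c>0$ such that $$\inf_{\widehat\mu}\ \sup_{P\in\mathcal P_{r,s}(R)}\mathbb E_P\big\|\widehat\mu-\mu_r(P)\big\|^2_{L^2(\mathcal I^r,\rho^{\otimes r})}\ \ge\ c\left(\frac1n+(mn)^{-s\beta/(s\beta+1)}\right)$$ for all sufficiently large $n$, uniformly over integers $m\ge r$. Here the infimum is over all estimators $\widehat\mu$ based on the discretely observed curves $(t_{ij},y_{ij})_{1\le i\le n,1\le j\le m}$, and $\mathbb E_P$ averages over the latent curves, the design points and the Gaussian errors.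
   Context: $\mathcal I$ is a compact metric space with Borel probability measure $\rho$; $k:\mathcal I\times\mathcal I\to\mathbb R$ is a continuous positive-definite kernel. The operator $(Tf)(x)=\int k(x,x')f(x')\,d\rho(x')$ on $L^2(\mathcal I,\rho)$ has positive eigenvalues $\lambda_1\ge\lambda_2\ge\cdots$ (repeated by multiplicity) and $L^2$-orthonormal eigenfunctions $e_j$ with continuous representatives. For $s\ge0$, $[H]^s=\{\sum_ja_j\lambda_j^{s/2}e_j:(a_j)\in\ell^2\}\subseteq L^2(\mathcal I,\rho)$ with norm $\|\sum_ja_j\lambda_j^{s/2}e_j\|_{[H]^s}^2=\sum_ja_j^2$. $\mathcal P_{r,s}(R)$ is the class of probability measures $P$ (laws of a random function $X$ on $\mathcal I$) such that $X\in[H]^s$ almost surely and $\mathbb E_P\|X\|_{[H]^s}^{2r}\le R^{2r}$. $\mu_r(P)=\mathbb E_PX^{\otimes r}$, i.e. $\mu_r(P)(t_1,\dots,t_r)=\mathbb E_P[X(t_1)\cdots X(t_r)]$. Observation model: $X_1,\dots,X_n$ are i.i.d. with law $P$; $t_{ij}$ ($1\le i\le n$, $1\le j\le m$) are i.i.d. from $\rho$; $y_{ij}=X_i(t_{ij})+\varepsilon_{ij}$ with $\varepsilon_{ij}$ i.i.d. $N(0,\sigma^2)$; the curves, design points and errors are mutually independent. *)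

theory Defs
  imports "HOL-Probability.Probability"
begin

definition continuous_pd_kernel :: "('a::metric_space \<Rightarrow> 'a \<Rightarrow> real) \<Rightarrow> bool" where
  "continuous_pd_kernel k \<longleftrightarrow>
     continuous_on UNIV (\<lambda>(x, y). k x y) \<and>
     (\<forall>x y. k x y = k y x) \<and>
     (\<forall>A c. finite A \<longrightarrow> (\<Sum>x\<in>A. \<Sum>y\<in>A. c x * c y * k x y) \<ge> 0)"

text \<open>Elements of $L^2$ are handled as functions rather than as classes modulo almost everywhere
  equality; equality in $L^2$ is equality \<open>AE x in \<rho>\<close>.\<close>

definition L2_fun :: "'a measure \<Rightarrow> ('a \<Rightarrow> real) set" where
  "L2_fun \<rho> = {f \<in> borel_measurable \<rho>. integrable \<rho> (\<lambda>x. (f x)\<^sup>2)}"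

definition kernel_op :: "'a measure \<Rightarrow> ('a \<Rightarrow> 'a \<Rightarrow> real) \<Rightarrow> ('a \<Rightarrow> real) \<Rightarrow> 'a \<Rightarrow> real" where
  "kernel_op \<rho> k f x = (\<integral>x'. k x x' * f x' \<partial>\<rho>)"

text \<open>Eigenvalues are indexed from 0, so \<open>lam j\<close> is $\lambda_{j+1}$. The sequences are infinite: only
  operators of infinite rank are considered. The last conjunct says that \<open>lam\<close> lists every positive
  eigenvalue with its full multiplicity; as a sum over an infinite set is 0, it
  also forces each eigenspace to be finite-dimensional.\<close>

definition eigensystem ::
  "('a::metric_space) measure \<Rightarrow> ('a \<Rightarrow> 'a \<Rightarrow> real) \<Rightarrow> (nat \<Rightarrow> real) \<Rightarrow> (nat \<Rightarrow> 'a \<Rightarrow> real) \<Rightarrow> bool" where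
  "eigensystem \<rho> k lam e \<longleftrightarrow>
     (\<forall>j. lam j > 0) \<and> decseq lam \<and>
     (\<forall>j. continuous_on UNIV (e j)) \<and>
     (\<forall>i j. (\<integral>x. e i x * e j x \<partial>\<rho>) = (if i = j then 1 else 0)) \<and>
     (\<forall>j. AE x in \<rho>. kernel_op \<rho> k (e j) x = lam j * e j x) \<and>
     (\<forall>l>0. \<forall>f\<in>L2_fun \<rho>. (AE x in \<rho>. kernel_op \<rho> k f x = l * f x) \<longrightarrow>
        (\<exists>c. AE x in \<rho>. f x = (\<Sum>j | lam j = l. c j * e j x)))"

text \<open>\<open>Hs_expansion \<rho> lam e s a f\<close>: the series $\sum_j a_j \lambda_j^{s/2} e_j$ with square-summable
  \<open>a\<close> converges to \<open>f\<close> in $L^2$.\<close>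

definition Hs_expansion ::
  "'a measure \<Rightarrow> (nat \<Rightarrow> real) \<Rightarrow> (nat \<Rightarrow> 'a \<Rightarrow> real) \<Rightarrow> real \<Rightarrow> (nat \<Rightarrow> real) \<Rightarrow> ('a \<Rightarrow> real) \<Rightarrow> bool" where
  "Hs_expansion \<rho> lam e s a f \<longleftrightarrow>
     f \<in> L2_fun \<rho> \<and> summable (\<lambda>j. (a j)\<^sup>2) \<and>
     (\<lambda>N. \<integral>\<^sup>+x. ennreal ((f x - (\<Sum>j<N. a j * lam j powr (s / 2) * e j x))\<^sup>2) \<partial>\<rho>)
       \<longlonglongrightarrow> 0"

definition Hs_space ::
  "'a measure \<Rightarrow> (nat \<Rightarrow> real) \<Rightarrow> (nat \<Rightarrow> 'a \<Rightarrow> real) \<Rightarrow> real \<Rightarrow> ('a \<Rightarrow> real) set" where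
  "Hs_space \<rho> lam e s = {f. \<exists>a. Hs_expansion \<rho> lam e s a f}"

text \<open>For an eigensystem the coefficient sequence of \<open>f \<in> Hs_space\<close> is unique, because the
  \<open>e j\<close> are orthonormal and the \<open>lam j\<close> positive. The norm is meaningful on \<open>Hs_space\<close> only.\<close>

definition Hs_norm ::
  "'a measure \<Rightarrow> (nat \<Rightarrow> real) \<Rightarrow> (nat \<Rightarrow> 'a \<Rightarrow> real) \<Rightarrow> real \<Rightarrow> ('a \<Rightarrow> real) \<Rightarrow> real" where
  "Hs_norm \<rho> lam e s f = sqrt (\<Sum>j. ((THE a. Hs_expansion \<rho> lam e s a f) j)\<^sup>2)"

text \<open>A law is a probability measure on paths, whose \<open>\<sigma>\<close>-algebra is only required to make the
  evaluation \<open>(f, x) \<mapsto> f x\<close> jointly measurable, i.e. the canonical process is a measurable random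
  function. The \<open>\<sigma>\<close>-algebra (and \<open>space P\<close>) is not fixed, as no single one on
  all functions has this property. For \<open>s * \<beta> > 1\<close> and \<open>lam j\<close> of order $j^{-\beta}$, almost every
  point is one where $\sum_j \lambda_j^s e_j^2$ converges, so every random element of $[H]^s$ has such
  a version (the pointwise sum of its expansion), and the choice of version affects neither the
  law of the observations nor the moment function as an element of $L^2$.\<close>

definition law_class ::
  "'a measure \<Rightarrow> (nat \<Rightarrow> real) \<Rightarrow> (nat \<Rightarrow> 'a \<Rightarrow> real) \<Rightarrow> nat \<Rightarrow> real \<Rightarrow> real \<Rightarrow> ('a \<Rightarrow> real) measure set" where
  "law_class \<rho> lam e r s R = {P.
     prob_space P \<and>
     (\<lambda>(f, x). f x) \<in> borel_measurable (P \<Otimes>\<^sub>M \<rho>) \<and>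
     (AE f in P. f \<in> Hs_space \<rho> lam e s) \<and>
     (\<integral>\<^sup>+f. ennreal (Hs_norm \<rho> lam e s f ^ (2 * r)) \<partial>P) \<le> ennreal (R ^ (2 * r))}"

text \<open>A point of the \<open>r\<close>-fold product is a function on \<open>{..<r}\<close>.\<close>

definition moment_fun :: "nat \<Rightarrow> ('a \<Rightarrow> real) measure \<Rightarrow> (nat \<Rightarrow> 'a) \<Rightarrow> real" where
  "moment_fun r P u = (\<integral>f. (\<Prod>l<r. f (u l)) \<partial>P)"

definition latent_space ::
  "'a measure \<Rightarrow> real \<Rightarrow> nat \<Rightarrow> nat \<Rightarrow> ('a \<Rightarrow> real) measure \<Rightarrow>
     ((nat \<Rightarrow> 'a \<Rightarrow> real) \<times> (nat \<times> nat \<Rightarrow> 'a) \<times> (nat \<times> nat \<Rightarrow> real)) measure" where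
  "latent_space \<rho> \<sigma> n m P =
     (\<Pi>\<^sub>M i\<in>{..<n}. P) \<Otimes>\<^sub>M
     ((\<Pi>\<^sub>M ij\<in>{..<n} \<times> {..<m}. \<rho>) \<Otimes>\<^sub>M
      (\<Pi>\<^sub>M ij\<in>{..<n} \<times> {..<m}. density lborel (\<lambda>x. ennreal (normal_density 0 \<sigma> x))))"

definition observe ::
  "nat \<Rightarrow> nat \<Rightarrow> (nat \<Rightarrow> 'a \<Rightarrow> real) \<times> (nat \<times> nat \<Rightarrow> 'a) \<times> (nat \<times> nat \<Rightarrow> real) \<Rightarrow>
     (nat \<times> nat \<Rightarrow> 'a \<times> real)" where
  "observe n m = (\<lambda>(X, t, \<epsilon>). \<lambda>ij\<in>{..<n} \<times> {..<m}. (t ij, X (fst ij) (t ij) + \<epsilon> ij))"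

text \<open>Estimators need not take values in $L^2$: where they do not, the loss is infinite.\<close>

definition estimators ::
  "nat \<Rightarrow> nat \<Rightarrow> nat \<Rightarrow> ((nat \<times> nat \<Rightarrow> ('a::metric_space) \<times> real) \<Rightarrow> (nat \<Rightarrow> 'a) \<Rightarrow> real) set" where
  "estimators n m r = {est. (\<lambda>(d, u). est d u) \<in> borel_measurable
     ((\<Pi>\<^sub>M ij\<in>{..<n} \<times> {..<m}. borel \<Otimes>\<^sub>M borel) \<Otimes>\<^sub>M (\<Pi>\<^sub>M l\<in>{..<r}. borel))}"

definition risk ::
  "'a measure \<Rightarrow> real \<Rightarrow> nat \<Rightarrow> nat \<Rightarrow> nat \<Rightarrow> ((nat \<times> nat \<Rightarrow> 'a \<times> real) \<Rightarrow> (nat \<Rightarrow> 'a) \<Rightarrow> real) \<Rightarrow>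
     ('a \<Rightarrow> real) measure \<Rightarrow> ennreal" where
  "risk \<rho> \<sigma> n m r est P =
     (\<integral>\<^sup>+\<omega>. (\<integral>\<^sup>+u. ennreal ((est (observe n m \<omega>) u - moment_fun r P u)\<^sup>2) \<partial>(\<Pi>\<^sub>M l\<in>{..<r}. \<rho>))
        \<partial>latent_space \<rho> \<sigma> n m P)"

end

theory Submission
  imports Defs
begin

text \<open>Two families of laws give the two terms. For \<open>1 / n\<close> the curve is \<open>\<xi> * a * e 0\<close> with a Bernoulli
  variable \<open>\<xi>\<close> of success probability $1/2 \pm 1/(4 \sqrt{n})$, and even the fully observed curves do not
  tell the two values apart. For the nonparametric term the curve is deterministic, equal to \<open>a * e 0\<close> plus
  \<open>\<delta>\<close> times the sum of the \<open>e j\<close> over a subset \<open>A\<close> of \<open>{J..<2*J}\<close>, where $\delta^2$ is of order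
  $1/(mn)$ and \<open>J\<close> of order $(mn)^{1/(s\beta+1)}$; changing one membership \<open>j \<in> A\<close> cannot be detected
  from \<open>m * n\<close> noisy values. The component \<open>a * e 0\<close> makes the problem linear: the coefficient of the moment function
  along \<open>e j \<otimes> e 0 \<otimes> \<dots> \<otimes> e 0\<close> is \<open>\<delta> * a ^ (r - 1)\<close> for \<open>j \<in> A\<close> and 0
  otherwise. By Bessel's inequality the loss dominates the sum of the squared errors of these coefficients,
  and each of them is bounded below by a two-point argument. The two-point bound uses the Hellinger affinity,
  as it stays under control although the \<open>e j\<close> are not uniformly bounded.\<close>

section \<open>Two-point bounds\<close>

lemma PiM_density:
  fixes q :: "'i \<Rightarrow> 'b \<Rightarrow> ennreal"
  assumes I: "finite I" and M: "sigma_finite_measure M"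
    and [measurable]: "\<And>i. i \<in> I \<Longrightarrow> q i \<in> borel_measurable M"
    and q: "\<And>i. i \<in> I \<Longrightarrow> sigma_finite_measure (density M (q i))"
  shows "PiM I (\<lambda>i. density M (q i)) = density (PiM I (\<lambda>i. M)) (\<lambda>x. \<Prod>i\<in>I. q i (x i))"
proof -
  interpret M: sigma_finite_measure M by (rule M)
  \<comment> \<open>\<open>product_sigma_finite\<close> asks for sigma-finiteness at every index,
    while \<open>q\<close> is controlled on \<open>I\<close> only. The default \<open>M\<close>
    elsewhere leaves the product over \<open>I\<close> unchanged.\<close>
  define Q where "Q i = (if i \<in> I then density M (q i) else M)" for i
  interpret P: product_sigma_finite "\<lambda>i. M" by standard
  interpret Q: product_sigma_finite Q
    by (rule product_sigma_finite.intro) (auto simp: Q_def q M)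
  have eqQ: "PiM I (\<lambda>i. density M (q i)) = PiM I Q"
    by (rule PiM_cong) (auto simp: Q_def)
  have sQ: "sets (PiM I Q) = sets (PiM I (\<lambda>i. M))"
    by (rule sets_PiM_cong) (auto simp: Q_def)
  show ?thesis unfolding eqQ
  proof (rule Q.PiM_eqI[symmetric])
    fix A assume "\<And>i. i \<in> I \<Longrightarrow> A i \<in> sets (Q i)"
    then have A[measurable]: "\<And>i. i \<in> I \<Longrightarrow> A i \<in> sets M" by (simp add: Q_def)
    have "emeasure (density (PiM I (\<lambda>i. M)) (\<lambda>x. \<Prod>i\<in>I. q i (x i))) (Pi\<^sub>E I A)
        = (\<integral>\<^sup>+x. (\<Prod>i\<in>I. q i (x i)) * indicator (Pi\<^sub>E I A) x \<partial>PiM I (\<lambda>i. M))"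
      by (subst emeasure_density) (auto intro!: sets_PiM_I_finite I)
    also have "\<dots> = (\<integral>\<^sup>+x. (\<Prod>i\<in>I. q i (x i) * indicator (A i) (x i)) \<partial>PiM I (\<lambda>i. M))"
    proof (rule nn_integral_cong)
      fix x assume "x \<in> space (PiM I (\<lambda>i. M))"
      then have "indicator (Pi\<^sub>E I A) x = (\<Prod>i\<in>I. indicator (A i) (x i) :: ennreal)"
        using I by (auto simp: indicator_def space_PiM PiE_def Pi_def extensional_def)
      then show "(\<Prod>i\<in>I. q i (x i)) * indicator (Pi\<^sub>E I A) x
          = (\<Prod>i\<in>I. q i (x i) * indicator (A i) (x i))"
        by (simp add: prod.distrib)
    qed
    also have "\<dots> = (\<Prod>i\<in>I. \<integral>\<^sup>+x. q i x * indicator (A i) x \<partial>M)"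
      by (rule P.product_nn_integral_prod[OF I]) measurable
    also have "\<dots> = (\<Prod>i\<in>I. emeasure (Q i) (A i))"
      by (intro prod.cong refl) (simp add: Q_def emeasure_density)
    finally show "emeasure (density (PiM I (\<lambda>i. M)) (\<lambda>x. \<Prod>i\<in>I. q i (x i))) (Pi\<^sub>E I A)
      = (\<Prod>i\<in>I. emeasure (Q i) (A i))" .
  qed (simp_all add: I sQ)
qed

lemma distr_PiM_componentwise:
  assumes I: "finite I" and N: "prob_space N"
    and [measurable]: "\<And>i. i \<in> I \<Longrightarrow> g i \<in> measurable N M"
  shows "distr (PiM I (\<lambda>i. N)) (PiM I (\<lambda>i. M)) (\<lambda>x. \<lambda>i\<in>I. g i (x i)) = PiM I (\<lambda>i. distr N M (g i))"
proof -
  interpret N: prob_space N by (rule N)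
  \<comment> \<open>The measure on the empty space is a sigma-finite default for the indices outside
    \<open>I\<close>, where \<open>g i\<close> may fail to be measurable.\<close>
  define Q where "Q i = (if i \<in> I then distr N M (g i) else count_space {})" for i
  interpret P: product_prob_space "\<lambda>i. N" by standard
  interpret Q: product_sigma_finite Q
    by (rule product_sigma_finite.intro)
      (auto simp: Q_def intro!: prob_space_imp_sigma_finite N.prob_space_distr
        sigma_finite_measure_count_space_countable)
  have eqQ: "PiM I (\<lambda>i. distr N M (g i)) = PiM I Q"
    by (rule PiM_cong) (auto simp: Q_def)
  have sQ: "sets (PiM I Q) = sets (PiM I (\<lambda>i. M))"
    by (rule sets_PiM_cong) (auto simp: Q_def)
  show ?thesis unfolding eqQ
  proof (rule Q.PiM_eqI)
    fix A assume "\<And>i. i \<in> I \<Longrightarrow> A i \<in> sets (Q i)"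
    then have A[measurable]: "\<And>i. i \<in> I \<Longrightarrow> A i \<in> sets M" by (simp add: Q_def)
    have "emeasure (distr (PiM I (\<lambda>i. N)) (PiM I (\<lambda>i. M)) (\<lambda>x. \<lambda>i\<in>I. g i (x i))) (Pi\<^sub>E I A)
        = emeasure (PiM I (\<lambda>i. N)) ((\<lambda>x. \<lambda>i\<in>I. g i (x i)) -` (Pi\<^sub>E I A) \<inter> space (PiM I (\<lambda>i. N)))"
      by (subst emeasure_distr) (auto intro!: sets_PiM_I_finite I measurable_restrict)
    also have "(\<lambda>x. \<lambda>i\<in>I. g i (x i)) -` (Pi\<^sub>E I A) \<inter> space (PiM I (\<lambda>i. N))
        = Pi\<^sub>E I (\<lambda>i. g i -` A i \<inter> space N)"
      by (auto simp: space_PiM PiE_def Pi_def)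
    also have "emeasure (PiM I (\<lambda>i. N)) \<dots> = (\<Prod>i\<in>I. emeasure N (g i -` A i \<inter> space N))"
      by (rule P.emeasure_PiM[OF I]) auto
    also have "\<dots> = (\<Prod>i\<in>I. emeasure (Q i) (A i))"
      by (intro prod.cong refl) (simp add: Q_def emeasure_distr)
    finally show "emeasure (distr (PiM I (\<lambda>i. N)) (PiM I (\<lambda>i. M)) (\<lambda>x. \<lambda>i\<in>I. g i (x i))) (Pi\<^sub>E I A)
      = (\<Prod>i\<in>I. emeasure (Q i) (A i))" .
  qed (simp_all add: I sQ)
qed

section \<open>Hellinger affinity and the two-point inequality\<close>

lemma ennreal_add_square_le:
  fixes a b :: ennreal
  shows "(a + b)\<^sup>2 \<le> 2 * (a\<^sup>2 + b\<^sup>2)"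
proof (cases a; cases b)
  fix x y :: real
  assume xy: "0 \<le> x" "0 \<le> y" "a = ennreal x" "b = ennreal y"
  have "(x + y)\<^sup>2 \<le> 2 * (x\<^sup>2 + y\<^sup>2)"
    using sum_squares_ge_zero[of "x - y" 0] by (simp add: power2_eq_square algebra_simps)
  then have "ennreal ((x + y)\<^sup>2) \<le> ennreal (2 * (x\<^sup>2 + y\<^sup>2))" by (rule ennreal_leI)
  also have "\<dots> = 2 * (a\<^sup>2 + b\<^sup>2)"
    using xy by (simp add: ennreal_mult' ennreal_power)
  finally show ?thesis using xy by (simp add: ennreal_power flip: ennreal_plus)
qed (auto simp: power2_eq_square ennreal_top_mult ennreal_mult_top)

text \<open>The triangle inequality
  \<open>|\<theta>1 - \<theta>0| <= |T - \<theta>0| + |T - \<theta>1|\<close> is integrated against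
  \<open>sqrt (q0 * q1)\<close>. By Cauchy-Schwarz each of the two resulting integrals is at most
  the root of one risk times the root of a mass bounded by 1. The factor 1/2 is the price of
  squaring a sum of two terms.\<close>

lemma two_point_hellinger:
  fixes q0 q1 T :: "'b \<Rightarrow> real"
  assumes [measurable]: "q0 \<in> borel_measurable M" "q1 \<in> borel_measurable M" "T \<in> borel_measurable M"
    and nn: "\<And>x. 0 \<le> q0 x" "\<And>x. 0 \<le> q1 x"
    and q0: "(\<integral>\<^sup>+x. ennreal (q0 x) \<partial>M) \<le> 1" and q1: "(\<integral>\<^sup>+x. ennreal (q1 x) \<partial>M) \<le> 1"
  shows "ennreal ((\<theta>1 - \<theta>0)\<^sup>2 / 2) * (\<integral>\<^sup>+x. ennreal (sqrt (q0 x * q1 x)) \<partial>M)\<^sup>2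
    \<le> (\<integral>\<^sup>+x. ennreal (q0 x) * ennreal ((T x - \<theta>0)\<^sup>2) \<partial>M)
      + (\<integral>\<^sup>+x. ennreal (q1 x) * ennreal ((T x - \<theta>1)\<^sup>2) \<partial>M)"
proof -
  \<comment> \<open>The density \<open>p\<close> carries the loss and \<open>q\<close> contributes
    only its mass; the inequality is used twice, with \<open>q0\<close> and \<open>q1\<close>
    exchanging roles.\<close>
  have CS: "(\<integral>\<^sup>+x. ennreal (\<bar>T x - \<theta>\<bar> * sqrt (p x)) * ennreal (sqrt (q x)) \<partial>M)\<^sup>2
      \<le> (\<integral>\<^sup>+x. ennreal (p x) * ennreal ((T x - \<theta>)\<^sup>2) \<partial>M)"
    if [measurable]: "p \<in> borel_measurable M" "q \<in> borel_measurable M"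
      and p: "\<And>x. 0 \<le> p x" and q: "\<And>x. 0 \<le> q x" "(\<integral>\<^sup>+x. ennreal (q x) \<partial>M) \<le> 1"
    for p q :: "'b \<Rightarrow> real" and \<theta>
  proof -
    have "(\<integral>\<^sup>+x. ennreal (\<bar>T x - \<theta>\<bar> * sqrt (p x)) * ennreal (sqrt (q x)) \<partial>M)\<^sup>2
        \<le> (\<integral>\<^sup>+x. (ennreal (\<bar>T x - \<theta>\<bar> * sqrt (p x)))\<^sup>2 \<partial>M) * (\<integral>\<^sup>+x. (ennreal (sqrt (q x)))\<^sup>2 \<partial>M)"
      by (rule Cauchy_Schwarz_nn_integral) measurable
    also have "\<dots> = (\<integral>\<^sup>+x. ennreal (p x) * ennreal ((T x - \<theta>)\<^sup>2) \<partial>M) * (\<integral>\<^sup>+x. ennreal (q x) \<partial>M)"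
      by (intro arg_cong2[where f="(*)"] nn_integral_cong)
         (simp_all add: p q ennreal_power power_mult_distrib mult.commute flip: ennreal_mult)
    also have "\<dots> \<le> (\<integral>\<^sup>+x. ennreal (p x) * ennreal ((T x - \<theta>)\<^sup>2) \<partial>M) * 1"
      by (intro mult_left_mono q) simp
    finally show ?thesis by simp
  qed
  have "ennreal \<bar>\<theta>1 - \<theta>0\<bar> * (\<integral>\<^sup>+x. ennreal (sqrt (q0 x * q1 x)) \<partial>M)
      = (\<integral>\<^sup>+x. ennreal (\<bar>\<theta>1 - \<theta>0\<bar> * sqrt (q0 x * q1 x)) \<partial>M)"
    by (simp add: ennreal_mult' nn_integral_cmult)
  also have "\<dots> \<le> (\<integral>\<^sup>+x. ennreal (\<bar>T x - \<theta>0\<bar> * sqrt (q0 x)) * ennreal (sqrt (q1 x))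
      + ennreal (\<bar>T x - \<theta>1\<bar> * sqrt (q1 x)) * ennreal (sqrt (q0 x)) \<partial>M)"
  proof (rule nn_integral_mono)
    fix x
    have "\<bar>\<theta>1 - \<theta>0\<bar> * sqrt (q0 x * q1 x) \<le> (\<bar>T x - \<theta>0\<bar> + \<bar>T x - \<theta>1\<bar>) * sqrt (q0 x * q1 x)"
      by (intro mult_right_mono) (auto simp: nn)
    also have "\<dots> = \<bar>T x - \<theta>0\<bar> * sqrt (q0 x) * sqrt (q1 x) + \<bar>T x - \<theta>1\<bar> * sqrt (q1 x) * sqrt (q0 x)"
      by (simp add: real_sqrt_mult algebra_simps)
    finally show "ennreal (\<bar>\<theta>1 - \<theta>0\<bar> * sqrt (q0 x * q1 x))
      \<le> ennreal (\<bar>T x - \<theta>0\<bar> * sqrt (q0 x)) * ennreal (sqrt (q1 x))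
      + ennreal (\<bar>T x - \<theta>1\<bar> * sqrt (q1 x)) * ennreal (sqrt (q0 x))"
      by (simp add: nn ennreal_leI flip: ennreal_mult ennreal_plus)
  qed
  also have "\<dots> = (\<integral>\<^sup>+x. ennreal (\<bar>T x - \<theta>0\<bar> * sqrt (q0 x)) * ennreal (sqrt (q1 x)) \<partial>M)
      + (\<integral>\<^sup>+x. ennreal (\<bar>T x - \<theta>1\<bar> * sqrt (q1 x)) * ennreal (sqrt (q0 x)) \<partial>M)"
    (is "_ = ?U + ?V") by (rule nn_integral_add) measurable
  finally have "(ennreal \<bar>\<theta>1 - \<theta>0\<bar> * (\<integral>\<^sup>+x. ennreal (sqrt (q0 x * q1 x)) \<partial>M))\<^sup>2 \<le> (?U + ?V)\<^sup>2"
    by (intro power_mono) auto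
  also have "\<dots> \<le> 2 * (?U\<^sup>2 + ?V\<^sup>2)" by (rule ennreal_add_square_le)
  also have "\<dots> \<le> 2 * ((\<integral>\<^sup>+x. ennreal (q0 x) * ennreal ((T x - \<theta>0)\<^sup>2) \<partial>M)
      + (\<integral>\<^sup>+x. ennreal (q1 x) * ennreal ((T x - \<theta>1)\<^sup>2) \<partial>M))"
    by (intro mult_left_mono add_mono CS nn q0 q1) auto
  finally have *: "ennreal ((\<theta>1 - \<theta>0)\<^sup>2) * (\<integral>\<^sup>+x. ennreal (sqrt (q0 x * q1 x)) \<partial>M)\<^sup>2
      \<le> 2 * ((\<integral>\<^sup>+x. ennreal (q0 x) * ennreal ((T x - \<theta>0)\<^sup>2) \<partial>M)
      + (\<integral>\<^sup>+x. ennreal (q1 x) * ennreal ((T x - \<theta>1)\<^sup>2) \<partial>M))" (is "_ * ?I \<le> 2 * ?E")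
    by (simp add: power_mult_distrib ennreal_power)
  have "ennreal ((\<theta>1 - \<theta>0)\<^sup>2 / 2) * ?I = ennreal (1/2) * (ennreal ((\<theta>1 - \<theta>0)\<^sup>2) * ?I)"
    by (subst mult.assoc[symmetric], subst ennreal_mult[symmetric]) auto
  also have "\<dots> \<le> ennreal (1/2) * (2 * ?E)" by (intro mult_left_mono *) auto
  also have "\<dots> = ?E"
  proof -
    have "ennreal (1/2) * 2 = 1"
      unfolding ennreal_numeral[symmetric] by (subst ennreal_mult[symmetric]) auto
    then show ?thesis by (simp only: mult.assoc[symmetric] mult_1_left)
  qed
  finally show ?thesis .
qed

text \<open>By Tonelli the affinity of two product laws is the product of the affinities. For random
  curves \<open>M\<close> will count atoms; for noisy values it will be Lebesgue measure, with means
  that vary with the index \<open>i\<close>.\<close>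

lemma two_point_product_hellinger:
  fixes q0 q1 :: "'i \<Rightarrow> 'b \<Rightarrow> real"
  assumes I: "finite I" and M: "sigma_finite_measure M"
    and [measurable]: "\<And>i. i \<in> I \<Longrightarrow> q0 i \<in> borel_measurable M" "\<And>i. i \<in> I \<Longrightarrow> q1 i \<in> borel_measurable M"
    and nn: "\<And>i x. 0 \<le> q0 i x" "\<And>i x. 0 \<le> q1 i x"
    and p0: "\<And>i. i \<in> I \<Longrightarrow> prob_space (density M (q0 i))"
    and p1: "\<And>i. i \<in> I \<Longrightarrow> prob_space (density M (q1 i))"
    and T[measurable]: "T \<in> borel_measurable (PiM I (\<lambda>i. M))"
  shows "ennreal ((\<theta>1 - \<theta>0)\<^sup>2 / 2) * (\<Prod>i\<in>I. \<integral>\<^sup>+x. ennreal (sqrt (q0 i x * q1 i x)) \<partial>M)\<^sup>2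
    \<le> (\<integral>\<^sup>+x. ennreal ((T x - \<theta>0)\<^sup>2) \<partial>PiM I (\<lambda>i. density M (q0 i)))
      + (\<integral>\<^sup>+x. ennreal ((T x - \<theta>1)\<^sup>2) \<partial>PiM I (\<lambda>i. density M (q1 i)))"
proof -
  interpret M: sigma_finite_measure M by (rule M)
  interpret P: product_sigma_finite "\<lambda>i. M" by standard
  let ?P = "PiM I (\<lambda>i. M)"
  have dens: "PiM I (\<lambda>i. density M (q i)) = density ?P (\<lambda>x. ennreal (\<Prod>i\<in>I. q i (x i)))"
    and mass: "(\<integral>\<^sup>+x. ennreal (\<Prod>i\<in>I. q i (x i)) \<partial>?P) \<le> 1"
    if [measurable]: "\<And>i. i \<in> I \<Longrightarrow> q i \<in> borel_measurable M"
      and nn: "\<And>i x. 0 \<le> q i x" and p: "\<And>i. i \<in> I \<Longrightarrow> prob_space (density M (q i))"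
    for q :: "'i \<Rightarrow> 'b \<Rightarrow> real"
  proof -
    have "PiM I (\<lambda>i. density M (q i)) = density ?P (\<lambda>x. \<Prod>i\<in>I. ennreal (q i (x i)))"
      by (rule PiM_density[OF I M]) (auto intro!: prob_space_imp_sigma_finite p)
    then show "PiM I (\<lambda>i. density M (q i)) = density ?P (\<lambda>x. ennreal (\<Prod>i\<in>I. q i (x i)))"
      by (simp add: prod_ennreal nn)
    have "(\<integral>\<^sup>+x. ennreal (\<Prod>i\<in>I. q i (x i)) \<partial>?P) = (\<integral>\<^sup>+x. (\<Prod>i\<in>I. ennreal (q i (x i))) \<partial>?P)"
      by (simp add: prod_ennreal nn)
    also have "\<dots> = (\<Prod>i\<in>I. \<integral>\<^sup>+x. ennreal (q i x) \<partial>M)"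
      by (rule P.product_nn_integral_prod[OF I]) measurable
    also have "\<dots> = (\<Prod>i\<in>I. 1)"
    proof (rule prod.cong[OF refl])
      fix i assume i: "i \<in> I"
      then have [measurable]: "q i \<in> borel_measurable M" by simp
      show "(\<integral>\<^sup>+x. ennreal (q i x) \<partial>M) = 1"
        using prob_space.emeasure_space_1[OF p[OF i]]
        by (simp add: emeasure_density cong: nn_integral_cong)
    qed
    finally show "(\<integral>\<^sup>+x. ennreal (\<Prod>i\<in>I. q i (x i)) \<partial>?P) \<le> 1" by simp
  qed
  have aff: "(\<Prod>i\<in>I. \<integral>\<^sup>+x. ennreal (sqrt (q0 i x * q1 i x)) \<partial>M)
      = (\<integral>\<^sup>+x. ennreal (sqrt ((\<Prod>i\<in>I. q0 i (x i)) * (\<Prod>i\<in>I. q1 i (x i)))) \<partial>?P)"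
  proof -
    have "sqrt (\<Prod>i\<in>I. f i) = (\<Prod>i\<in>I. sqrt (f i))" for f :: "'i \<Rightarrow> real"
      using I by (induction rule: finite_induct) (auto simp: real_sqrt_mult)
    then have "(\<integral>\<^sup>+x. ennreal (sqrt ((\<Prod>i\<in>I. q0 i (x i)) * (\<Prod>i\<in>I. q1 i (x i)))) \<partial>?P)
        = (\<integral>\<^sup>+x. (\<Prod>i\<in>I. ennreal (sqrt (q0 i (x i) * q1 i (x i)))) \<partial>?P)"
      by (simp add: prod.distrib[symmetric] prod_ennreal nn)
    also have "\<dots> = (\<Prod>i\<in>I. \<integral>\<^sup>+x. ennreal (sqrt (q0 i x * q1 i x)) \<partial>M)"
      by (rule P.product_nn_integral_prod[OF I]) measurable
    finally show ?thesis by simp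
  qed
  show ?thesis unfolding aff dens[OF _ nn(1) p0, simplified] dens[OF _ nn(2) p1, simplified]
    by (simp add: nn_integral_density dens nn p0 p1)
       (rule two_point_hellinger; auto simp: nn prod_nonneg intro!: mass p0 p1)
qed

text \<open>Completing the square around the midpoint of the two means shows that the geometric mean
  of the densities is a constant times the normal density centred there, which has mass 1.\<close>

lemma hellinger_normal:
  assumes "\<sigma> > 0"
  shows "(\<integral>\<^sup>+x. ennreal (sqrt (normal_density \<mu> \<sigma> x * normal_density \<nu> \<sigma> x)) \<partial>lborel)
    = ennreal (exp (- (\<mu> - \<nu>)\<^sup>2 / (8 * \<sigma>\<^sup>2)))"
proof -
  have "sqrt (normal_density \<mu> \<sigma> x * normal_density \<nu> \<sigma> x)
      = exp (- (\<mu> - \<nu>)\<^sup>2 / (8 * \<sigma>\<^sup>2)) * normal_density ((\<mu> + \<nu>) / 2) \<sigma> x" for x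
  proof (rule real_sqrt_unique)
    have "- (x - \<mu>)\<^sup>2 / (2 * \<sigma>\<^sup>2) + - (x - \<nu>)\<^sup>2 / (2 * \<sigma>\<^sup>2)
       = 2 * (- (\<mu> - \<nu>)\<^sup>2 / (8 * \<sigma>\<^sup>2) + - (x - (\<mu> + \<nu>) / 2)\<^sup>2 / (2 * \<sigma>\<^sup>2))"
      using assms by (simp add: field_simps) (simp add: power2_eq_square algebra_simps)
    then have "exp (- (x - \<mu>)\<^sup>2 / (2 * \<sigma>\<^sup>2)) * exp (- (x - \<nu>)\<^sup>2 / (2 * \<sigma>\<^sup>2))
       = (exp (- (\<mu> - \<nu>)\<^sup>2 / (8 * \<sigma>\<^sup>2)) * exp (- (x - (\<mu> + \<nu>) / 2)\<^sup>2 / (2 * \<sigma>\<^sup>2)))\<^sup>2"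
      by (simp only: flip: exp_add exp_double)
    then show "(exp (- (\<mu> - \<nu>)\<^sup>2 / (8 * \<sigma>\<^sup>2)) * normal_density ((\<mu> + \<nu>) / 2) \<sigma> x)\<^sup>2
        = normal_density \<mu> \<sigma> x * normal_density \<nu> \<sigma> x"
      unfolding normal_density_def by (simp add: power2_eq_square mult.commute mult.left_commute)
  qed simp
  moreover have "(\<integral>\<^sup>+x. ennreal (normal_density ((\<mu> + \<nu>) / 2) \<sigma> x) \<partial>lborel) = 1"
    using assms by (simp add: nn_integral_eq_integral)
  ultimately show ?thesis
    by (simp add: ennreal_mult' nn_integral_cmult)
qed

lemma distr_normal_shift:
  assumes "\<sigma> > 0"
  shows "distr (density lborel (\<lambda>x. ennreal (normal_density 0 \<sigma> x))) lborel (\<lambda>x. \<mu> + x)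
    = density lborel (\<lambda>x. ennreal (normal_density \<mu> \<sigma> x))"
proof -
  let ?N = "density lborel (\<lambda>x. ennreal (normal_density 0 \<sigma> x))"
  interpret N: prob_space ?N using assms by (rule prob_space_normal_density)
  have "distributed ?N lborel (\<lambda>x. x) (normal_density 0 \<sigma>)"
    unfolding distributed_def by (auto intro!: distr_id2)
  from N.normal_density_affine[OF this, of 1 \<mu>] assms show ?thesis
    by (simp add: distributed_def)
qed

text \<open>The subsets of \<open>S\<close> are the vertices of a cube, and \<open>B\<close> bounds
  the average over the vertices of the total error. For each direction \<open>j\<close> the vertices
  pair off into \<open>2 ^ (card S - 1)\<close> edges, each contributing at least \<open>v\<close>,
  so the average error in coordinate \<open>j\<close> is at least \<open>v / 2\<close>.\<close>

lemma assouad: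
  fixes E :: "'j set \<Rightarrow> 'j \<Rightarrow> ennreal"
  assumes S: "finite S"
    and B: "\<And>A. A \<subseteq> S \<Longrightarrow> (\<Sum>j\<in>S. E A j) \<le> B"
    and v: "\<And>A j. j \<in> S \<Longrightarrow> A \<subseteq> S - {j} \<Longrightarrow> v \<le> E A j + E (insert j A) j"
  shows "of_nat (card S) * v \<le> 2 * B"
proof -
  have edge: "2 ^ (card S - 1) * v \<le> (\<Sum>A\<in>Pow S. E A j)" if j: "j \<in> S" for j
  proof -
    have "Pow S = Pow (S - {j}) \<union> insert j ` Pow (S - {j})"
      using j by (metis Pow_insert insert_Diff)
    moreover have "inj_on (insert j) (Pow (S - {j}))" by (auto simp: inj_on_def)
    ultimately have "(\<Sum>A\<in>Pow S. E A j) = (\<Sum>A\<in>Pow (S - {j}). E A j + E (insert j A) j)"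
      by (simp add: sum.union_disjoint sum.reindex sum.distrib S disjoint_iff image_iff)
        (subst sum.union_disjoint; auto simp: S sum.reindex)
    moreover have "(\<Sum>A\<in>Pow (S - {j}). v) \<le> (\<Sum>A\<in>Pow (S - {j}). E A j + E (insert j A) j)"
      by (intro sum_mono v j) auto
    ultimately show ?thesis using S j by (simp add: card_Pow of_nat_power)
  qed
  have "of_nat (card S) * (2 ^ (card S - 1) * v) = (\<Sum>j\<in>S. 2 ^ (card S - 1) * v)" by simp
  also have "\<dots> \<le> (\<Sum>j\<in>S. \<Sum>A\<in>Pow S. E A j)" by (intro sum_mono edge)
  also have "\<dots> = (\<Sum>A\<in>Pow S. \<Sum>j\<in>S. E A j)" by (rule sum.swap)
  also have "\<dots> \<le> (\<Sum>A\<in>Pow S. B)" by (intro sum_mono B) auto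
  also have "\<dots> = 2 ^ card S * B" using S by (simp add: card_Pow of_nat_power)
  finally have *: "of_nat (card S) * (2 ^ (card S - 1) * v) \<le> 2 ^ card S * B" .
  show ?thesis
  proof (cases "card S")
    case (Suc k)
    \<comment> \<open>A factor can be cancelled in \<open>ennreal\<close> only if it is finite and
      nonzero. When \<open>card S = 0\<close> the left-hand side vanishes.\<close>
    have "(2::ennreal) ^ k \<noteq> top" by (simp add: power_eq_top_ennreal)
    moreover have "2 ^ k * (of_nat (card S) * v) \<le> 2 ^ k * (2 * B)"
      using * by (simp add: Suc mult_ac)
    ultimately show ?thesis by (subst (asm) ennreal_mult_le_mult_iff) auto
  qed simp
qed

section \<open>Orthonormal expansions\<close>

lemma L2_fun_mult_integrable:
  assumes "f \<in> L2_fun M" "g \<in> L2_fun M"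
  shows "integrable M (\<lambda>x. f x * g x)"
proof (rule Bochner_Integration.integrable_bound)
  show "integrable M (\<lambda>x. (f x)\<^sup>2 + (g x)\<^sup>2)"
    using assms by (auto simp: L2_fun_def)
  show "(\<lambda>x. f x * g x) \<in> borel_measurable M"
    using assms by (auto simp: L2_fun_def)
  have "\<bar>a * b\<bar> \<le> a\<^sup>2 + b\<^sup>2" for a b :: real
  proof -
    have "2 * (\<bar>a\<bar> * \<bar>b\<bar>) \<le> \<bar>a\<bar>\<^sup>2 + \<bar>b\<bar>\<^sup>2" "0 \<le> \<bar>a\<bar> * \<bar>b\<bar>"
      using sum_squares_bound[of "\<bar>a\<bar>" "\<bar>b\<bar>"] by auto
    then have "\<bar>a\<bar> * \<bar>b\<bar> \<le> \<bar>a\<bar>\<^sup>2 + \<bar>b\<bar>\<^sup>2" by linarith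
    then show ?thesis by (simp add: abs_mult)
  qed
  then show "AE x in M. norm (f x * g x) \<le> norm ((f x)\<^sup>2 + (g x)\<^sup>2)"
    by (auto simp del: abs_mult)
qed

lemma L2_fun_cmult:
  "f \<in> L2_fun M \<Longrightarrow> (\<lambda>x. c * f x) \<in> L2_fun M"
  by (auto simp: L2_fun_def power_mult_distrib)

lemma L2_fun_add:
  assumes "f \<in> L2_fun M" "g \<in> L2_fun M"
  shows "(\<lambda>x. f x + g x) \<in> L2_fun M"
  using assms L2_fun_mult_integrable[OF assms]
  by (auto simp: L2_fun_def power2_sum mult.assoc)

lemma L2_fun_sum:
  "(\<And>j. j \<in> S \<Longrightarrow> f j \<in> L2_fun M) \<Longrightarrow> (\<lambda>x. \<Sum>j\<in>S. f j x) \<in> L2_fun M"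
proof (induction S rule: infinite_finite_induct)
  case (insert j S)
  then show ?case by (simp add: L2_fun_add)
qed (auto simp: L2_fun_def)

lemma integral_sum_mult_orthonormal:
  fixes \<psi> :: "'j \<Rightarrow> 'b \<Rightarrow> real"
  assumes S: "finite S" and \<psi>: "\<And>j. j \<in> S \<Longrightarrow> \<psi> j \<in> L2_fun M" and i: "\<psi> i \<in> L2_fun M"
    and on: "\<And>j. j \<in> S \<Longrightarrow> (\<integral>x. \<psi> j x * \<psi> i x \<partial>M) = (if j = i then 1 else 0)"
  shows "(\<integral>x. (\<Sum>j\<in>S. b j * \<psi> j x) * \<psi> i x \<partial>M) = (if i \<in> S then b i else 0)"
proof -
  have "(\<integral>x. (\<Sum>j\<in>S. b j * \<psi> j x) * \<psi> i x \<partial>M) = (\<integral>x. (\<Sum>j\<in>S. b j * (\<psi> j x * \<psi> i x)) \<partial>M)"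
    by (simp add: sum_distrib_right mult.assoc)
  also have "\<dots> = (\<Sum>j\<in>S. b j * (\<integral>x. \<psi> j x * \<psi> i x \<partial>M))"
    by (subst Bochner_Integration.integral_sum) (auto intro!: L2_fun_mult_integrable \<psi> i)
  also have "\<dots> = (\<Sum>j\<in>S. if j = i then b j else 0)"
    by (intro sum.cong refl) (auto simp: on)
  finally show ?thesis using S by simp
qed

text \<open>The candidate \<open>T\<close> is an arbitrary measurable function; if it is not square integrable, then
  the right-hand side is infinite.\<close>

lemma bessel_projection:
  fixes \<psi> :: "'j \<Rightarrow> 'b \<Rightarrow> real"
  assumes S: "finite S" and \<psi>: "\<And>j. j \<in> S \<Longrightarrow> \<psi> j \<in> L2_fun M"
    and on: "\<And>i j. i \<in> S \<Longrightarrow> j \<in> S \<Longrightarrow> (\<integral>x. \<psi> i x * \<psi> j x \<partial>M) = (if i = j then 1 else 0)"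
    and T: "T \<in> borel_measurable M" and \<mu>: "\<mu> \<in> L2_fun M"
  shows "ennreal (\<Sum>j\<in>S. ((\<integral>x. T x * \<psi> j x \<partial>M) - (\<integral>x. \<mu> x * \<psi> j x \<partial>M))\<^sup>2)
    \<le> (\<integral>\<^sup>+x. ennreal ((T x - \<mu> x)\<^sup>2) \<partial>M)"
proof (cases "(\<integral>\<^sup>+x. ennreal ((T x - \<mu> x)\<^sup>2) \<partial>M) = \<infinity>")
  case False
  define G where "G x = T x - \<mu> x" for x
  have Gm: "G \<in> borel_measurable M" using T \<mu> by (auto simp: G_def[abs_def] L2_fun_def)
  have "(\<integral>\<^sup>+x. ennreal ((G x)\<^sup>2) \<partial>M) < \<infinity>" using False by (simp add: G_def less_top)
  with Gm have G: "G \<in> L2_fun M"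
    by (auto simp: L2_fun_def integrable_iff_bounded)
  \<comment> \<open>A finite loss puts the candidate itself into L2, so its coefficients are genuine
    inner products and not default values of the integral.\<close>
  have T': "T \<in> L2_fun M" using L2_fun_add[OF G \<mu>] by (simp add: G_def)
  define c where "c j = (\<integral>x. G x * \<psi> j x \<partial>M)" for j
  have c: "(\<integral>x. T x * \<psi> j x \<partial>M) - (\<integral>x. \<mu> x * \<psi> j x \<partial>M) = c j" if "j \<in> S" for j
    unfolding c_def G_def
    by (simp add: left_diff_distrib L2_fun_mult_integrable T' \<mu> \<psi>[OF that])
  \<comment> \<open>\<open>h\<close> is the orthogonal projection of the error \<open>G\<close> onto
    the span. Expanding the nonnegative squared norm of \<open>G - h\<close> gives Bessel's
    inequality, since the inner product of \<open>G\<close> with \<open>h\<close> and the squared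
    norm of \<open>h\<close> both equal the sum of the squared coefficients.\<close>
  define h where "h x = (\<Sum>j\<in>S. c j * \<psi> j x)" for x
  have h: "h \<in> L2_fun M" unfolding h_def[abs_def] by (intro L2_fun_sum L2_fun_cmult \<psi>)
  have L: "(\<integral>x. F x * h x \<partial>M) = (\<Sum>j\<in>S. c j * (\<integral>x. F x * \<psi> j x \<partial>M))" if F: "F \<in> L2_fun M" for F
  proof -
    have "(\<integral>x. F x * h x \<partial>M) = (\<integral>x. (\<Sum>j\<in>S. c j * (F x * \<psi> j x)) \<partial>M)"
      by (simp add: h_def sum_distrib_left algebra_simps)
    then show ?thesis
      by (subst (asm) Bochner_Integration.integral_sum)
        (auto intro!: L2_fun_mult_integrable F \<psi>)
  qed
  have hh: "(\<integral>x. h x * h x \<partial>M) = (\<Sum>j\<in>S. (c j)\<^sup>2)"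
  proof -
    have "(\<integral>x. h x * \<psi> j x \<partial>M) = c j" if "j \<in> S" for j
      unfolding h_def using integral_sum_mult_orthonormal[OF S \<psi> \<psi>[OF that] on] that by simp
    then show ?thesis by (simp add: L[OF h] power2_eq_square)
  qed
  have Gh: "(\<integral>x. G x * h x \<partial>M) = (\<Sum>j\<in>S. (c j)\<^sup>2)"
    by (simp add: L[OF G] c_def power2_eq_square)
  have "0 \<le> (\<integral>x. (G x - h x)\<^sup>2 \<partial>M)" by simp
  also have "\<dots> = (\<integral>x. (G x)\<^sup>2 - 2 * (G x * h x) + h x * h x \<partial>M)"
    by (simp add: power2_eq_square algebra_simps)
  also have "\<dots> = (\<integral>x. (G x)\<^sup>2 \<partial>M) - 2 * (\<integral>x. G x * h x \<partial>M) + (\<integral>x. h x * h x \<partial>M)"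
    using G L2_fun_mult_integrable[OF G h] L2_fun_mult_integrable[OF h h]
    by (simp add: L2_fun_def)
  finally have "(\<Sum>j\<in>S. (c j)\<^sup>2) \<le> (\<integral>x. (G x)\<^sup>2 \<partial>M)" by (simp add: hh Gh)
  then have "ennreal (\<Sum>j\<in>S. (c j)\<^sup>2) \<le> ennreal (\<integral>x. (G x)\<^sup>2 \<partial>M)" by (rule ennreal_leI)
  also have "\<dots> = (\<integral>\<^sup>+x. ennreal ((G x)\<^sup>2) \<partial>M)"
    using G by (subst nn_integral_eq_integral) (auto simp: L2_fun_def)
  finally show ?thesis by (simp add: c G_def cong: sum.cong)
qed simp

section \<open>Continuous orthonormal systems and the smoothness spaces they generate\<close>

locale orthonormal_system = prob_space \<rho> for \<rho> :: "'a::metric_space measure" +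
  fixes e :: "nat \<Rightarrow> 'a \<Rightarrow> real" and lam :: "nat \<Rightarrow> real"
  assumes sets_rho: "sets \<rho> = sets borel"
    and cont: "\<And>j. continuous_on UNIV (e j)"
    and on: "\<And>i j. (\<integral>x. e i x * e j x \<partial>\<rho>) = (if i = j then 1 else 0)"
    and lam_pos: "\<And>j. lam j > 0"
begin

lemma e_measurable[measurable]: "e j \<in> borel_measurable borel"
  by (intro borel_measurable_continuous_onI cont)

lemma e_L2: "e j \<in> L2_fun \<rho>"
proof -
  \<comment> \<open>The integral is 1, whereas a non-integrable function would have Bochner integral
    0.\<close>
  have "integrable \<rho> (\<lambda>x. e j x * e j x)"
    using on[of j j] not_integrable_integral_eq[of \<rho> "\<lambda>x. e j x * e j x"] by fastforce
  then show ?thesis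
    by (auto simp: L2_fun_def power2_eq_square measurable_cong_sets[OF sets_rho refl])
qed

definition comb :: "nat set \<Rightarrow> (nat \<Rightarrow> real) \<Rightarrow> 'a \<Rightarrow> real" where
  "comb S b x = (\<Sum>j\<in>S. b j * e j x)"

lemma comb_measurable[measurable]: "comb S b \<in> borel_measurable borel"
  unfolding comb_def[abs_def] by measurable

lemma comb_L2: "comb S b \<in> L2_fun \<rho>"
  unfolding comb_def[abs_def] by (intro L2_fun_sum L2_fun_cmult e_L2)

lemma integral_comb:
  "finite S \<Longrightarrow> (\<integral>x. comb S b x * e i x \<partial>\<rho>) = (if i \<in> S then b i else 0)"
  unfolding comb_def by (rule integral_sum_mult_orthonormal) (auto simp: e_L2 on)

text \<open>Bessel's inequality in the single direction \<open>e j\<close>, applied to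
  \<open>f\<close> and a partial sum with \<open>N > j\<close>, bounds the squared discrepancy of
  the coefficients by an error that tends to 0. This gives the uniqueness that the definite
  description in \<open>Hs_norm\<close> relies on.\<close>

lemma Hs_expansion_coeff:
  assumes "Hs_expansion \<rho> lam e s a f"
  shows "a j * lam j powr (s / 2) = (\<integral>x. f x * e j x \<partial>\<rho>)"
proof -
  define b where "b i = a i * lam i powr (s / 2)" for i
  have f: "f \<in> L2_fun \<rho>"
    and lim: "(\<lambda>N. \<integral>\<^sup>+x. ennreal ((f x - comb {..<N} b x)\<^sup>2) \<partial>\<rho>) \<longlonglongrightarrow> 0"
    using assms by (auto simp: Hs_expansion_def comb_def b_def)
  define \<delta> where "\<delta> = (\<integral>x. f x * e j x \<partial>\<rho>) - b j"
  have "ennreal (\<delta>\<^sup>2) \<le> (\<integral>\<^sup>+x. ennreal ((f x - comb {..<N} b x)\<^sup>2) \<partial>\<rho>)" if "N > j" for N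
  proof -
    have "ennreal (\<Sum>j\<in>{j}. ((\<integral>x. f x * e j x \<partial>\<rho>) - (\<integral>x. comb {..<N} b x * e j x \<partial>\<rho>))\<^sup>2)
        \<le> (\<integral>\<^sup>+x. ennreal ((f x - comb {..<N} b x)\<^sup>2) \<partial>\<rho>)"
      by (rule bessel_projection) (use f in \<open>auto simp: e_L2 comb_L2 on, simp add: L2_fun_def\<close>)
    then show ?thesis using that by (simp add: integral_comb \<delta>_def)
  qed
  then have "ennreal (\<delta>\<^sup>2) \<le> 0"
    by (intro LIMSEQ_le_const[OF lim]) (auto intro!: exI[of _ "Suc j"])
  then show ?thesis by (simp add: \<delta>_def b_def ennreal_eq_0_iff)
qed

lemma comb_Hs:
  assumes S: "finite S"
  shows "comb S b \<in> Hs_space \<rho> lam e s"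
    and "Hs_norm \<rho> lam e s (comb S b) = sqrt (\<Sum>j\<in>S. (b j)\<^sup>2 / lam j powr s)"
proof -
  define a where "a j = (if j \<in> S then b j / lam j powr (s / 2) else 0)" for j
  have ab: "a j * lam j powr (s / 2) = (if j \<in> S then b j else 0)" for j
    using lam_pos[of j] by (simp add: a_def)
  have ex: "Hs_expansion \<rho> lam e s a (comb S b)"
    unfolding Hs_expansion_def
  proof (intro conjI)
    show "comb S b \<in> L2_fun \<rho>" by (rule comb_L2)
    show "summable (\<lambda>j. (a j)\<^sup>2)"
      by (rule summable_finite[OF S]) (auto simp: a_def)
    have "eventually (\<lambda>N. (\<integral>\<^sup>+x. ennreal ((comb S b x
        - (\<Sum>j<N. a j * lam j powr (s / 2) * e j x))\<^sup>2) \<partial>\<rho>) = 0) sequentially"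
    proof (rule eventually_sequentiallyI)
      \<comment> \<open>From this \<open>N\<close> on the partial sum is exactly
        \<open>comb S b\<close>; inserting 0 keeps the maximum meaningful for empty
        \<open>S\<close>.\<close>
      fix N assume N: "Suc (Max (insert 0 S)) \<le> N"
      have "j < N" if "j \<in> S" for j
      proof -
        have "j \<le> Max (insert 0 S)" using S that by (intro Max_ge) auto
        with N show ?thesis by linarith
      qed
      then have "S \<subseteq> {..<N}" by auto
      then have "(\<Sum>j<N. a j * lam j powr (s / 2) * e j x) = comb S b x" for x
        unfolding comb_def
        by (intro sum.mono_neutral_cong_right) (auto simp: ab)
      then show "(\<integral>\<^sup>+x. ennreal ((comb S b x
        - (\<Sum>j<N. a j * lam j powr (s / 2) * e j x))\<^sup>2) \<partial>\<rho>) = 0" by simp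
    qed
    then show "(\<lambda>N. \<integral>\<^sup>+x. ennreal ((comb S b x
        - (\<Sum>j<N. a j * lam j powr (s / 2) * e j x))\<^sup>2) \<partial>\<rho>) \<longlonglongrightarrow> 0"
      by (rule tendsto_eventually)
  qed
  then show "comb S b \<in> Hs_space \<rho> lam e s" by (auto simp: Hs_space_def)
  have "(THE a. Hs_expansion \<rho> lam e s a (comb S b)) = a"
  proof (rule the_equality)
    show "Hs_expansion \<rho> lam e s a (comb S b)" by (rule ex)
    fix a' assume a': "Hs_expansion \<rho> lam e s a' (comb S b)"
    show "a' = a"
    proof
      fix j
      have "a' j * lam j powr (s / 2) = a j * lam j powr (s / 2)"
        by (simp only: Hs_expansion_coeff[OF a'] Hs_expansion_coeff[OF ex])
      then show "a' j = a j" using lam_pos[of j] by simp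
    qed
  qed
  then have "Hs_norm \<rho> lam e s (comb S b) = sqrt (\<Sum>j. (a j)\<^sup>2)" by (simp add: Hs_norm_def)
  also have "(\<Sum>j. (a j)\<^sup>2) = (\<Sum>j\<in>S. (a j)\<^sup>2)"
    by (rule suminf_finite[OF S]) (auto simp: a_def)
  also have "\<dots> = (\<Sum>j\<in>S. (b j)\<^sup>2 / lam j powr s)"
  proof (intro sum.cong refl)
    fix j assume "j \<in> S"
    have "(lam j powr (s / 2))\<^sup>2 = lam j powr s"
      by (simp add: power2_eq_square flip: powr_add)
    with \<open>j \<in> S\<close> show "(a j)\<^sup>2 = (b j)\<^sup>2 / lam j powr s" by (simp add: a_def power_divide)
  qed
  finally show "Hs_norm \<rho> lam e s (comb S b) = sqrt (\<Sum>j\<in>S. (b j)\<^sup>2 / lam j powr s)" .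
qed

section \<open>Tensor products of basis functions\<close>

definition tensor_basis :: "nat \<Rightarrow> nat \<Rightarrow> (nat \<Rightarrow> 'a) \<Rightarrow> real" where
  "tensor_basis r j u = (\<Prod>l<r. e (if l = 0 then j else 0) (u l))"

lemma integral_tensor:
  fixes r :: nat
  assumes "\<And>l. l < r \<Longrightarrow> f l \<in> L2_fun \<rho>" "\<And>l. l < r \<Longrightarrow> g l \<in> L2_fun \<rho>"
  shows "(\<integral>u. (\<Prod>l<r. f l (u l)) * (\<Prod>l<r. g l (u l)) \<partial>(\<Pi>\<^sub>M l\<in>{..<r}. \<rho>))
    = (\<Prod>l<r. \<integral>x. f l x * g l x \<partial>\<rho>)"
proof -
  interpret P: product_prob_space "\<lambda>l. \<rho>" "{..<r}" by standard
  show ?thesis unfolding prod.distrib[symmetric]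
    by (rule P.product_integral_prod) (simp, auto intro!: L2_fun_mult_integrable assms)
qed

lemma tensor_L2:
  fixes r :: nat
  assumes f: "\<And>l. l < r \<Longrightarrow> f l \<in> L2_fun \<rho>"
  shows "(\<lambda>u. \<Prod>l<r. f l (u l)) \<in> L2_fun (\<Pi>\<^sub>M l\<in>{..<r}. \<rho>)"
proof -
  interpret P: product_prob_space "\<lambda>l. \<rho>" "{..<r}" by standard
  have [measurable]: "f l \<in> borel_measurable \<rho>" if "l < r" for l
    using f[OF that] by (simp add: L2_fun_def)
  have "integrable (\<Pi>\<^sub>M l\<in>{..<r}. \<rho>) (\<lambda>u. \<Prod>l<r. (f l (u l))\<^sup>2)"
    by (rule P.product_integrable_prod) (simp, use f in \<open>auto simp: L2_fun_def\<close>)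
  moreover have "(\<lambda>u. \<Prod>l<r. f l (u l)) \<in> borel_measurable (\<Pi>\<^sub>M l\<in>{..<r}. \<rho>)"
    by measurable
  ultimately show ?thesis by (simp add: L2_fun_def prod_power_distrib)
qed

lemma tensor_basis_L2: "tensor_basis r j \<in> L2_fun (\<Pi>\<^sub>M l\<in>{..<r}. \<rho>)"
  unfolding tensor_basis_def[abs_def] by (rule tensor_L2) (rule e_L2)

lemma tensor_basis_orthonormal:
  assumes "r \<ge> 1"
  shows "(\<integral>u. tensor_basis r i u * tensor_basis r j u \<partial>(\<Pi>\<^sub>M l\<in>{..<r}. \<rho>)) = (if i = j then 1 else 0)"
proof -
  obtain r' where r: "r = Suc r'" using assms by (cases r) auto
  show ?thesis unfolding tensor_basis_def integral_tensor[OF e_L2 e_L2] r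
    by (simp add: on prod.lessThan_Suc_shift del: prod.lessThan_Suc)
qed

text \<open>The inner product factorizes over the coordinates. Since the test function varies with
  \<open>j\<close> in the first slot only, the result is linear in the \<open>j\<close>-th
  coefficient of \<open>f\<close> once the 0-th one is fixed. For \<open>j = 0\<close> it is the
  full \<open>r\<close>-th power.\<close>

lemma integral_power_tensor_basis:
  assumes "r \<ge> 1" "f \<in> L2_fun \<rho>"
  shows "(\<integral>u. (\<Prod>l<r. f (u l)) * tensor_basis r j u \<partial>(\<Pi>\<^sub>M l\<in>{..<r}. \<rho>))
    = (\<integral>x. f x * e j x \<partial>\<rho>) * (\<integral>x. f x * e 0 x \<partial>\<rho>) ^ (r - 1)"
proof -
  obtain r' where r: "r = Suc r'" using assms(1) by (cases r) auto
  have "(\<integral>u. (\<Prod>l<r. f (u l)) * tensor_basis r j u \<partial>(\<Pi>\<^sub>M l\<in>{..<r}. \<rho>))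
      = (\<Prod>l<r. \<integral>x. f x * e (if l = 0 then j else 0) x \<partial>\<rho>)"
    unfolding tensor_basis_def by (rule integral_tensor) (auto simp: e_L2 assms)
  then show ?thesis unfolding r by (simp add: prod.lessThan_Suc_shift del: prod.lessThan_Suc)
qed

text \<open>On a finite space of paths carrying its power set, evaluation is jointly measurable as
  soon as each path is measurable. All weights on the same \<open>F\<close> share the dominating
  measure \<open>count_space F\<close>, so their affinities are finite sums.\<close>

definition atomic_law :: "('a \<Rightarrow> real) set \<Rightarrow> (('a \<Rightarrow> real) \<Rightarrow> real) \<Rightarrow> ('a \<Rightarrow> real) measure" where
  "atomic_law F w = density (count_space F) (\<lambda>f. ennreal (w f))"

lemma space_atomic_law[simp]: "space (atomic_law F w) = F"
  and sets_atomic_law[simp, measurable_cong]: "sets (atomic_law F w) = sets (count_space F)"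
  by (auto simp: atomic_law_def)

lemma prob_space_atomic_law:
  assumes "finite F" "\<And>f. 0 \<le> w f" "(\<Sum>f\<in>F. w f) = 1"
  shows "prob_space (atomic_law F w)"
proof (rule prob_spaceI)
  have "emeasure (atomic_law F w) (space (atomic_law F w)) = (\<integral>\<^sup>+f. ennreal (w f) \<partial>count_space F)"
    unfolding atomic_law_def by (subst emeasure_density) (auto intro!: nn_integral_cong)
  also have "\<dots> = ennreal (\<Sum>f\<in>F. w f)"
    using assms by (simp add: nn_integral_count_space_finite)
  finally show "emeasure (atomic_law F w) (space (atomic_law F w)) = 1" using assms by simp
qed

lemma moment_atomic_law:
  assumes "finite F" "\<And>f. 0 \<le> w f"
  shows "moment_fun r (atomic_law F w) u = (\<Sum>f\<in>F. w f * (\<Prod>l<r. f (u l)))"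
  unfolding moment_fun_def atomic_law_def
  by (subst integral_density) (auto simp: assms lebesgue_integral_count_space_finite)

lemma evaluation_atomic_law:
  assumes "finite F" "\<And>f. f \<in> F \<Longrightarrow> f \<in> borel_measurable borel"
  shows "(\<lambda>(f, x). f x) \<in> borel_measurable (atomic_law F w \<Otimes>\<^sub>M \<rho>)"
proof -
  have eq: "sets (atomic_law F w \<Otimes>\<^sub>M \<rho>) = sets (count_space F \<Otimes>\<^sub>M \<rho>)"
    by (intro sets_pair_measure_cong) auto
  have "(\<lambda>(f, x). f x) \<in> borel_measurable (count_space F \<Otimes>\<^sub>M \<rho>)"
    by (rule measurable_pair_measure_countable1)
      (use assms in \<open>auto simp: countable_finite measurable_cong_sets[OF sets_rho refl]\<close>)
  then show ?thesis by (simp add: measurable_cong_sets[OF eq refl])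
qed

lemma atomic_law_in_class:
  assumes F: "finite F" "\<And>f. f \<in> F \<Longrightarrow> f \<in> borel_measurable borel"
    and w: "\<And>f. 0 \<le> w f" "(\<Sum>f\<in>F. w f) = 1"
    and H: "\<And>f. f \<in> F \<Longrightarrow> f \<in> Hs_space \<rho> lam e s"
      "\<And>f. f \<in> F \<Longrightarrow> 0 \<le> Hs_norm \<rho> lam e s f \<and> Hs_norm \<rho> lam e s f \<le> R"
  shows "atomic_law F w \<in> law_class \<rho> lam e r s R"
proof -
  interpret P: prob_space "atomic_law F w" by (rule prob_space_atomic_law[OF F(1) w])
  have "(\<integral>\<^sup>+f. ennreal (Hs_norm \<rho> lam e s f ^ (2 * r)) \<partial>atomic_law F w)
      \<le> (\<integral>\<^sup>+f. ennreal (R ^ (2 * r)) \<partial>atomic_law F w)"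
    using H(2) by (intro nn_integral_mono ennreal_leI power_mono) auto
  also have "\<dots> = ennreal (R ^ (2 * r))" using P.emeasure_space_1 by simp
  finally show ?thesis
    unfolding law_class_def mem_Collect_eq
    by (intro conjI P.prob_space_axioms evaluation_atomic_law[OF F] AE_I2) (simp_all add: H)
qed

section \<open>Reduction of the risk to coefficients\<close>

abbreviation data_space :: "nat \<Rightarrow> nat \<Rightarrow> (nat \<times> nat \<Rightarrow> 'a \<times> real) measure" where
  "data_space n m \<equiv> (\<Pi>\<^sub>M ij\<in>{..<n} \<times> {..<m}. borel \<Otimes>\<^sub>M borel)"

abbreviation design :: "nat \<Rightarrow> nat \<Rightarrow> (nat \<times> nat \<Rightarrow> 'a) measure" where
  "design n m \<equiv> (\<Pi>\<^sub>M ij\<in>{..<n} \<times> {..<m}. \<rho>)"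

abbreviation gauss :: "real \<Rightarrow> real measure" where
  "gauss \<sigma> \<equiv> density lborel (\<lambda>x. ennreal (normal_density 0 \<sigma> x))"

abbreviation noise :: "real \<Rightarrow> nat \<Rightarrow> nat \<Rightarrow> (nat \<times> nat \<Rightarrow> real) measure" where
  "noise \<sigma> n m \<equiv> (\<Pi>\<^sub>M ij\<in>{..<n} \<times> {..<m}. gauss \<sigma>)"

declare sets_rho[measurable_cong]

text \<open>A random path is evaluated at a random design point, so it is the joint measurability of
  evaluation that makes each response measurable.\<close>

lemma observe_measurable:
  assumes ev: "(\<lambda>(f, x). f x) \<in> borel_measurable (P \<Otimes>\<^sub>M \<rho>)"
  shows "observe n m \<in> measurable (latent_space \<rho> \<sigma> n m P) (data_space n m)"
  unfolding observe_def latent_space_def split_beta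
proof (rule measurable_restrict)
  fix ij :: "nat \<times> nat" assume ij: "ij \<in> {..<n} \<times> {..<m}"
  then have i: "fst ij \<in> {..<n}" by auto
  let ?L = "(\<Pi>\<^sub>M i\<in>{..<n}. P) \<Otimes>\<^sub>M (design n m \<Otimes>\<^sub>M noise \<sigma> n m)"
  have X: "(\<lambda>\<omega>. fst \<omega> (fst ij)) \<in> measurable ?L P"
    using i by measurable
  have t: "(\<lambda>\<omega>. fst (snd \<omega>) ij) \<in> measurable ?L \<rho>"
    using ij by measurable
  have \<epsilon>: "(\<lambda>\<omega>. snd (snd \<omega>) ij) \<in> borel_measurable ?L"
    using ij by measurable
  have "(\<lambda>\<omega>. fst \<omega> (fst ij) (fst (snd \<omega>) ij)) \<in> borel_measurable ?L"
    using measurable_compose[OF measurable_Pair[OF X t] ev] by simp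
  with t \<epsilon> show "(\<lambda>\<omega>. (fst (snd \<omega>) ij, fst \<omega> (fst ij) (fst (snd \<omega>) ij) + snd (snd \<omega>) ij))
      \<in> measurable ?L (borel \<Otimes>\<^sub>M borel)"
    by (simp add: measurable_cong_sets[OF refl sets_rho])
qed

text \<open>The integral takes its default value 0 when the integrand is not integrable. This is
  harmless: the integrand is integrable whenever \<open>est d\<close> is square integrable, and
  otherwise the loss against a square integrable target is infinite.\<close>

definition estimated_coeff ::
  "nat \<Rightarrow> ((nat \<times> nat \<Rightarrow> 'a \<times> real) \<Rightarrow> (nat \<Rightarrow> 'a) \<Rightarrow> real) \<Rightarrow> nat \<Rightarrow> (nat \<times> nat \<Rightarrow> 'a \<times> real) \<Rightarrow> real" where
  "estimated_coeff r est j d = (\<integral>u. est d u * tensor_basis r j u \<partial>(\<Pi>\<^sub>M l\<in>{..<r}. \<rho>))"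

lemma estimator_measurable:
  assumes "est \<in> estimators n m r"
  shows "(\<lambda>(d, u). est d u) \<in> borel_measurable (data_space n m \<Otimes>\<^sub>M (\<Pi>\<^sub>M l\<in>{..<r}. \<rho>))"
proof -
  have eq: "sets (data_space n m \<Otimes>\<^sub>M (\<Pi>\<^sub>M l\<in>{..<r}. \<rho>))
      = sets (data_space n m \<Otimes>\<^sub>M (\<Pi>\<^sub>M l\<in>{..<r}. (borel :: 'a measure)))"
    by (intro sets_pair_measure_cong sets_PiM_cong refl sets_rho)
  show ?thesis using assms
    by (simp only: estimators_def mem_Collect_eq measurable_cong_sets[OF eq refl])
qed

lemma estimated_coeff_measurable:
  assumes "est \<in> estimators n m r"
  shows "estimated_coeff r est j \<in> borel_measurable (data_space n m)"
proof -
  interpret P: product_prob_space "\<lambda>l. \<rho>" "{..<r}" by standard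
  note [measurable] = estimator_measurable[OF assms]
  have [measurable]: "tensor_basis r j \<in> borel_measurable (\<Pi>\<^sub>M l\<in>{..<r}. \<rho>)"
    using tensor_basis_L2 by (simp add: L2_fun_def)
  show ?thesis unfolding estimated_coeff_def[abs_def]
    by (rule P.P.borel_measurable_lebesgue_integral) measurable
qed

definition coeff_risk ::
  "real \<Rightarrow> nat \<Rightarrow> nat \<Rightarrow> ((nat \<times> nat \<Rightarrow> 'a \<times> real) \<Rightarrow> real) \<Rightarrow> ('a \<Rightarrow> real) measure \<Rightarrow> real \<Rightarrow> ennreal" where
  "coeff_risk \<sigma> n m T P \<theta> = (\<integral>\<^sup>+\<omega>. ennreal ((T (observe n m \<omega>) - \<theta>)\<^sup>2) \<partial>latent_space \<rho> \<sigma> n m P)"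

text \<open>Bessel's inequality is applied for each outcome separately and then integrated. It
  replaces the estimation of a function by finitely many scalar problems, whose risks add
  up.\<close>

lemma sum_coeff_risk_le_risk:
  assumes r: "r \<ge> 1" and est: "est \<in> estimators n m r"
    and ev: "(\<lambda>(f, x). f x) \<in> borel_measurable (P \<Otimes>\<^sub>M \<rho>)"
    and \<mu>: "moment_fun r P \<in> L2_fun (\<Pi>\<^sub>M l\<in>{..<r}. \<rho>)" and S: "finite S"
  shows "(\<Sum>j\<in>S. coeff_risk \<sigma> n m (estimated_coeff r est j) P
      (\<integral>u. moment_fun r P u * tensor_basis r j u \<partial>(\<Pi>\<^sub>M l\<in>{..<r}. \<rho>))) \<le> risk \<rho> \<sigma> n m r est P"
proof -
  let ?L = "latent_space \<rho> \<sigma> n m P" and ?R = "\<Pi>\<^sub>M l\<in>{..<r}. \<rho>"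
  define \<theta> where "\<theta> j = (\<integral>u. moment_fun r P u * tensor_basis r j u \<partial>?R)" for j
  note obs = observe_measurable[OF ev, of n m \<sigma>]
  note [measurable] = measurable_compose[OF obs estimated_coeff_measurable[OF est]]
  have "(\<Sum>j\<in>S. coeff_risk \<sigma> n m (estimated_coeff r est j) P (\<theta> j))
      = (\<integral>\<^sup>+\<omega>. (\<Sum>j\<in>S. ennreal ((estimated_coeff r est j (observe n m \<omega>) - \<theta> j)\<^sup>2)) \<partial>?L)"
    unfolding coeff_risk_def by (rule nn_integral_sum[symmetric]) measurable
  also have "\<dots> \<le> risk \<rho> \<sigma> n m r est P"
    unfolding risk_def
  proof (rule nn_integral_mono)
    fix \<omega> assume "\<omega> \<in> space ?L"
    with obs have d: "observe n m \<omega> \<in> space (data_space n m)"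
      by (rule measurable_space)
    have T: "est (observe n m \<omega>) \<in> borel_measurable ?R"
      using measurable_Pair2[OF estimator_measurable[OF est] d] by simp
    have "ennreal (\<Sum>j\<in>S. (estimated_coeff r est j (observe n m \<omega>) - \<theta> j)\<^sup>2)
        \<le> (\<integral>\<^sup>+u. ennreal ((est (observe n m \<omega>) u - moment_fun r P u)\<^sup>2) \<partial>?R)"
      unfolding estimated_coeff_def \<theta>_def
      by (rule bessel_projection) (auto simp: S tensor_basis_L2 tensor_basis_orthonormal[OF r] \<mu> intro!: T)
    then show "(\<Sum>j\<in>S. ennreal ((estimated_coeff r est j (observe n m \<omega>) - \<theta> j)\<^sup>2))
        \<le> (\<integral>\<^sup>+u. ennreal ((est (observe n m \<omega>) u - moment_fun r P u)\<^sup>2) \<partial>?R)"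
      by (simp add: sum_ennreal)
  qed
  finally show ?thesis by (simp add: \<theta>_def)
qed

text \<open>Conditionally on design and noise, the two experiments are products of \<open>n\<close> atomic laws.\<close>

lemma two_point_atomic_law:
  assumes \<sigma>: "\<sigma> > 0" and F: "finite F" "\<And>f. f \<in> F \<Longrightarrow> f \<in> borel_measurable borel"
    and w0: "\<And>f. 0 \<le> w0 f" "(\<Sum>f\<in>F. w0 f) = 1"
    and w1: "\<And>f. 0 \<le> w1 f" "(\<Sum>f\<in>F. w1 f) = 1"
    and T: "T \<in> borel_measurable (data_space n m)"
  shows "ennreal ((\<theta>1 - \<theta>0)\<^sup>2 / 2 * (\<Sum>f\<in>F. sqrt (w0 f * w1 f)) ^ (2 * n))
    \<le> coeff_risk \<sigma> n m T (atomic_law F w0) \<theta>0 + coeff_risk \<sigma> n m T (atomic_law F w1) \<theta>1"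
proof -
  interpret D: product_prob_space "\<lambda>ij. \<rho>" "{..<n} \<times> {..<m}" by standard
  interpret G: prob_space "gauss \<sigma>" by (rule prob_space_normal_density[OF \<sigma>])
  interpret N: product_prob_space "\<lambda>ij. gauss \<sigma>" "{..<n} \<times> {..<m}" by standard
  let ?DN = "design n m \<Otimes>\<^sub>M noise \<sigma> n m"
  interpret DN: pair_prob_space "design n m" "noise \<sigma> n m" by standard
  define K where "K \<theta> z X = ennreal ((T (observe n m (X, z)) - \<theta>)\<^sup>2)" for \<theta> z X
  \<comment> \<open>The conditional risk for frozen design and noise \<open>z\<close>; Tonelli makes
    the curves the inner variable.\<close>
  define E where "E w \<theta> z = (\<integral>\<^sup>+X. K \<theta> z X \<partial>(\<Pi>\<^sub>M i\<in>{..<n}. atomic_law F w))" for w \<theta> z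
  have *: "coeff_risk \<sigma> n m T (atomic_law F w) \<theta> = (\<integral>\<^sup>+z. E w \<theta> z \<partial>?DN)"
      "E w \<theta> \<in> borel_measurable ?DN"
      "z \<in> space ?DN \<Longrightarrow> (\<lambda>X. T (observe n m (X, z))) \<in> borel_measurable (\<Pi>\<^sub>M i\<in>{..<n}. atomic_law F w)"
    if w: "\<And>f. 0 \<le> w f" "(\<Sum>f\<in>F. w f) = 1" for w \<theta> z
  proof -
    interpret A: prob_space "atomic_law F w" by (rule prob_space_atomic_law[OF F(1) w])
    interpret P: product_prob_space "\<lambda>i. atomic_law F w" "{..<n}" by standard
    interpret L: pair_sigma_finite "\<Pi>\<^sub>M i\<in>{..<n}. atomic_law F w" ?DN by standard
    have L: "latent_space \<rho> \<sigma> n m (atomic_law F w) = (\<Pi>\<^sub>M i\<in>{..<n}. atomic_law F w) \<Otimes>\<^sub>M ?DN"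
      by (simp add: latent_space_def)
    have TL: "(\<lambda>\<omega>. T (observe n m \<omega>)) \<in> borel_measurable ((\<Pi>\<^sub>M i\<in>{..<n}. atomic_law F w) \<Otimes>\<^sub>M ?DN)"
      unfolding L[symmetric]
      by (rule measurable_compose[OF observe_measurable[OF evaluation_atomic_law[OF F]] T])
    then have [measurable]: "(\<lambda>(X, z). K \<theta> z X) \<in> borel_measurable ((\<Pi>\<^sub>M i\<in>{..<n}. atomic_law F w) \<Otimes>\<^sub>M ?DN)"
      unfolding K_def split_beta by simp
    show "coeff_risk \<sigma> n m T (atomic_law F w) \<theta> = (\<integral>\<^sup>+z. E w \<theta> z \<partial>?DN)"
      unfolding coeff_risk_def L E_def K_def
      by (intro L.nn_integral_snd[symmetric] measurable_compose[OF _ measurable_ennreal]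
        borel_measurable_power borel_measurable_diff borel_measurable_const TL)
    show "E w \<theta> \<in> borel_measurable ?DN"
      unfolding E_def[abs_def] by (rule P.P.borel_measurable_nn_integral) measurable
    show "(\<lambda>X. T (observe n m (X, z))) \<in> borel_measurable (\<Pi>\<^sub>M i\<in>{..<n}. atomic_law F w)"
      if "z \<in> space ?DN"
      using measurable_Pair1[OF TL that] by simp
  qed
  have eqP: "sets (\<Pi>\<^sub>M i\<in>{..<n}. atomic_law F w) = sets (\<Pi>\<^sub>M i\<in>{..<n}. count_space F)" for w
    by (intro sets_PiM_cong) auto
  have point: "ennreal ((\<theta>1 - \<theta>0)\<^sup>2 / 2 * (\<Sum>f\<in>F. sqrt (w0 f * w1 f)) ^ (2 * n)) \<le> E w0 \<theta>0 z + E w1 \<theta>1 z"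
    if z: "z \<in> space ?DN" for z
  proof -
    \<comment> \<open>With \<open>z\<close> frozen, the estimate is a statistic of the
      \<open>n\<close> fully known curves. The affinity of \<open>n\<close> independent draws is the
      \<open>n\<close>-th power of that of one draw.\<close>
    have "ennreal ((\<theta>1 - \<theta>0)\<^sup>2 / 2)
        * (\<Prod>i\<in>{..<n}. \<integral>\<^sup>+f. ennreal (sqrt (w0 f * w1 f)) \<partial>count_space F)\<^sup>2 \<le> E w0 \<theta>0 z + E w1 \<theta>1 z"
      unfolding E_def K_def atomic_law_def
    proof (rule two_point_product_hellinger)
      show "sigma_finite_measure (count_space F)"
        by (rule sigma_finite_measure_count_space_countable) (simp add: countable_finite F)
      show "(\<lambda>X. T (observe n m (X, z))) \<in> borel_measurable (\<Pi>\<^sub>M i\<in>{..<n}. count_space F)"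
        using *(3)[OF w0 z] by (simp only: measurable_cong_sets[OF eqP refl])
    qed (use w0 w1 prob_space_atomic_law[OF F(1)] in \<open>auto simp: atomic_law_def\<close>)
    moreover have "(\<integral>\<^sup>+f. ennreal (sqrt (w0 f * w1 f)) \<partial>count_space F) = ennreal (\<Sum>f\<in>F. sqrt (w0 f * w1 f))"
      by (simp add: nn_integral_count_space_finite F w0 w1 sum_ennreal)
    moreover have "0 \<le> (\<Sum>f\<in>F. sqrt (w0 f * w1 f))" by (intro sum_nonneg) (simp add: w0 w1)
    ultimately show ?thesis
      by (simp add: ennreal_power mult.commute flip: power_mult ennreal_mult')
  qed
  \<comment> \<open>The pointwise bound is constant in \<open>z\<close>, and design and noise
    together have total mass 1.\<close>
  have "ennreal ((\<theta>1 - \<theta>0)\<^sup>2 / 2 * (\<Sum>f\<in>F. sqrt (w0 f * w1 f)) ^ (2 * n))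
      = (\<integral>\<^sup>+z. ennreal ((\<theta>1 - \<theta>0)\<^sup>2 / 2 * (\<Sum>f\<in>F. sqrt (w0 f * w1 f)) ^ (2 * n)) \<partial>?DN)"
    using DN.P.emeasure_space_1 by simp
  also have "\<dots> \<le> (\<integral>\<^sup>+z. E w0 \<theta>0 z + E w1 \<theta>1 z \<partial>?DN)"
    by (intro nn_integral_mono point)
  also have "\<dots> = coeff_risk \<sigma> n m T (atomic_law F w0) \<theta>0 + coeff_risk \<sigma> n m T (atomic_law F w1) \<theta>1"
    using *(1,2)[OF w0] *(1,2)[OF w1] by (simp add: nn_integral_add)
  finally show ?thesis .
qed

abbreviation dirac :: "('a \<Rightarrow> real) \<Rightarrow> ('a \<Rightarrow> real) measure" where
  "dirac f \<equiv> atomic_law {f} (\<lambda>_. 1)"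

text \<open>Conditionally on the design, the two experiments are Gaussian with the same covariance.\<close>

lemma two_point_dirac:
  assumes \<sigma>: "\<sigma> > 0" and f[measurable]: "f \<in> borel_measurable borel" and g[measurable]: "g \<in> borel_measurable borel"
    and fg: "integrable \<rho> (\<lambda>x. (f x - g x)\<^sup>2)"
    and T[measurable]: "T \<in> borel_measurable (data_space n m)"
  shows "ennreal ((\<theta>1 - \<theta>0)\<^sup>2 / 2 * (1 - real (m * n) * (\<integral>x. (f x - g x)\<^sup>2 \<partial>\<rho>) / (4 * \<sigma>\<^sup>2)))
    \<le> coeff_risk \<sigma> n m T (dirac f) \<theta>0 + coeff_risk \<sigma> n m T (dirac g) \<theta>1"
proof -
  let ?I = "{..<n} \<times> {..<m}"
  interpret D: product_prob_space "\<lambda>ij. \<rho>" ?I by standard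
  interpret G: prob_space "gauss \<sigma>" by (rule prob_space_normal_density[OF \<sigma>])
  interpret N: product_prob_space "\<lambda>ij. gauss \<sigma>" ?I by standard
  interpret DN: pair_prob_space "design n m" "noise \<sigma> n m" by standard
  define Y where "Y h t \<epsilon> = (\<lambda>ij\<in>?I. (t ij, h (t ij) + \<epsilon> ij))" for h :: "'a \<Rightarrow> real" and t and \<epsilon> :: "nat \<times> nat \<Rightarrow> real"
  define E where "E h \<theta> t = (\<integral>\<^sup>+\<epsilon>. ennreal ((T (Y h t \<epsilon>) - \<theta>)\<^sup>2) \<partial>noise \<sigma> n m)" for h \<theta> t
  have Y[measurable]: "(\<lambda>(t, \<epsilon>). Y h t \<epsilon>) \<in> measurable (design n m \<Otimes>\<^sub>M noise \<sigma> n m) (data_space n m)"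
    if [measurable]: "h \<in> borel_measurable borel" for h
    unfolding Y_def split_beta by measurable
  have risk: "coeff_risk \<sigma> n m T (dirac h) \<theta> = (\<integral>\<^sup>+t. E h \<theta> t \<partial>design n m)"
    and E[measurable]: "E h \<theta> \<in> borel_measurable (design n m)"
    if h[measurable]: "h \<in> borel_measurable borel" for h \<theta>
  proof -
    interpret A: prob_space "dirac h" by (rule prob_space_atomic_law) auto
    interpret P: product_prob_space "\<lambda>i. dirac h" "{..<n}" by standard
    interpret L: pair_prob_space "\<Pi>\<^sub>M i\<in>{..<n}. dirac h" "design n m \<Otimes>\<^sub>M noise \<sigma> n m" by standard
    have "(\<lambda>\<omega>. T (observe n m \<omega>)) \<in> borel_measurable (latent_space \<rho> \<sigma> n m (dirac h))"
      by (rule measurable_compose[OF observe_measurable T], rule evaluation_atomic_law) (auto simp: h)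
    then have [measurable]: "(\<lambda>\<omega>. T (observe n m \<omega>)) \<in> borel_measurable ((\<Pi>\<^sub>M i\<in>{..<n}. dirac h) \<Otimes>\<^sub>M (design n m \<Otimes>\<^sub>M noise \<sigma> n m))"
      by (simp add: latent_space_def)
    have "coeff_risk \<sigma> n m T (dirac h) \<theta>
        = (\<integral>\<^sup>+X. \<integral>\<^sup>+z. ennreal ((T (observe n m (X, z)) - \<theta>)\<^sup>2) \<partial>(design n m \<Otimes>\<^sub>M noise \<sigma> n m) \<partial>(\<Pi>\<^sub>M i\<in>{..<n}. dirac h))"
      unfolding coeff_risk_def latent_space_def by (subst DN.P.nn_integral_fst) auto
    also have "\<dots> = (\<integral>\<^sup>+X. \<integral>\<^sup>+z. ennreal ((T (Y h (fst z) (snd z)) - \<theta>)\<^sup>2) \<partial>(design n m \<Otimes>\<^sub>M noise \<sigma> n m) \<partial>(\<Pi>\<^sub>M i\<in>{..<n}. dirac h))"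
    proof (rule nn_integral_cong)
      fix X assume "X \<in> space (\<Pi>\<^sub>M i\<in>{..<n}. dirac h)"
      \<comment> \<open>The space of \<open>dirac h\<close> is the singleton of \<open>h\<close>, so
        the paths equal \<open>h\<close> everywhere and the integral over them is trivial.\<close>
      then have X: "X i = h" if "i < n" for i using that by (auto simp: space_PiM PiE_def Pi_def)
      have "observe n m (X, z) = Y h (fst z) (snd z)" for z
        unfolding observe_def Y_def split_beta by (rule restrict_ext) (auto simp: X)
      then show "(\<integral>\<^sup>+z. ennreal ((T (observe n m (X, z)) - \<theta>)\<^sup>2) \<partial>(design n m \<Otimes>\<^sub>M noise \<sigma> n m))
          = (\<integral>\<^sup>+z. ennreal ((T (Y h (fst z) (snd z)) - \<theta>)\<^sup>2) \<partial>(design n m \<Otimes>\<^sub>M noise \<sigma> n m))" by simp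
    qed
    also have "\<dots> = (\<integral>\<^sup>+z. ennreal ((T (Y h (fst z) (snd z)) - \<theta>)\<^sup>2) \<partial>(design n m \<Otimes>\<^sub>M noise \<sigma> n m))"
      using P.P.emeasure_space_1 by simp
    also have "\<dots> = (\<integral>\<^sup>+t. E h \<theta> t \<partial>design n m)"
      unfolding E_def by (subst N.P.nn_integral_fst[symmetric]) (auto simp: split_beta)
    finally show "coeff_risk \<sigma> n m T (dirac h) \<theta> = (\<integral>\<^sup>+t. E h \<theta> t \<partial>design n m)" .
    show "E h \<theta> \<in> borel_measurable (design n m)"
      unfolding E_def[abs_def] by (rule N.P.borel_measurable_nn_integral) measurable
  qed
  \<comment> \<open>Chosen so that the affinity of the two Gaussian products for the design
    \<open>t\<close> is \<open>exp (- Z t / 2)\<close>; the two-point bound contains its square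
    \<open>exp (- Z t)\<close>.\<close>
  define Z where "Z t = (\<Sum>ij\<in>?I. (f (t ij) - g (t ij))\<^sup>2) / (4 * \<sigma>\<^sup>2)" for t
  have point: "ennreal ((\<theta>1 - \<theta>0)\<^sup>2 / 2 * exp (- Z t)) \<le> E f \<theta>0 t + E g \<theta>1 t"
    if t: "t \<in> space (design n m)" for t
  proof -
    \<comment> \<open>For a fixed design the only randomness is in the responses; \<open>y\<close>
      attaches the known design points to them.\<close>
    define y where "y x = (\<lambda>ij\<in>?I. (t ij, x ij))" for x :: "nat \<times> nat \<Rightarrow> real"
    have [measurable]: "y \<in> measurable (\<Pi>\<^sub>M ij\<in>?I. lborel) (data_space n m)"
      unfolding y_def[abs_def] by measurable
    have shift: "E h \<theta> t = (\<integral>\<^sup>+x. ennreal ((T (y x) - \<theta>)\<^sup>2)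
        \<partial>(\<Pi>\<^sub>M ij\<in>?I. density lborel (\<lambda>x. ennreal (normal_density (h (t ij)) \<sigma> x))))" for h \<theta>
    proof -
      have "(\<Pi>\<^sub>M ij\<in>?I. density lborel (\<lambda>x. ennreal (normal_density (h (t ij)) \<sigma> x)))
          = (\<Pi>\<^sub>M ij\<in>?I. distr (gauss \<sigma>) lborel ((+) (h (t ij))))"
        by (simp only: distr_normal_shift[OF \<sigma>])
      also have "\<dots> = distr (noise \<sigma> n m) (\<Pi>\<^sub>M ij\<in>?I. lborel) (\<lambda>\<epsilon>. \<lambda>ij\<in>?I. h (t ij) + \<epsilon> ij)"
        by (rule distr_PiM_componentwise[symmetric]) (auto intro: G.prob_space_axioms)
      finally have eq: "(\<Pi>\<^sub>M ij\<in>?I. density lborel (\<lambda>x. ennreal (normal_density (h (t ij)) \<sigma> x)))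
          = distr (noise \<sigma> n m) (\<Pi>\<^sub>M ij\<in>?I. lborel) (\<lambda>\<epsilon>. \<lambda>ij\<in>?I. h (t ij) + \<epsilon> ij)" .
      have "y (\<lambda>ij\<in>?I. h (t ij) + \<epsilon> ij) = Y h t \<epsilon>" for \<epsilon>
        unfolding y_def Y_def by (rule restrict_ext) auto
      then show ?thesis unfolding eq E_def
        by (subst nn_integral_distr) auto
    qed
    have "ennreal ((\<theta>1 - \<theta>0)\<^sup>2 / 2) * (\<Prod>ij\<in>?I. \<integral>\<^sup>+x. ennreal (sqrt (normal_density (f (t ij)) \<sigma> x
        * normal_density (g (t ij)) \<sigma> x)) \<partial>lborel)\<^sup>2 \<le> E f \<theta>0 t + E g \<theta>1 t"
      unfolding shift
      by (rule two_point_product_hellinger)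
        (auto intro!: prob_space_normal_density \<sigma> lborel.sigma_finite_measure_axioms)
    also have "(\<Prod>ij\<in>?I. \<integral>\<^sup>+x. ennreal (sqrt (normal_density (f (t ij)) \<sigma> x
        * normal_density (g (t ij)) \<sigma> x)) \<partial>lborel) = ennreal (\<Prod>ij\<in>?I. exp (- (f (t ij) - g (t ij))\<^sup>2 / (8 * \<sigma>\<^sup>2)))"
      by (simp add: hellinger_normal[OF \<sigma>] prod_ennreal)
    also have "(\<Prod>ij\<in>?I. exp (- (f (t ij) - g (t ij))\<^sup>2 / (8 * \<sigma>\<^sup>2))) = exp (- Z t / 2)"
      unfolding Z_def by (simp add: exp_sum[symmetric] sum_negf sum_divide_distrib)
    also have "ennreal ((\<theta>1 - \<theta>0)\<^sup>2 / 2) * (ennreal (exp (- Z t / 2)))\<^sup>2 = ennreal ((\<theta>1 - \<theta>0)\<^sup>2 / 2 * exp (- Z t))"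
      by (simp add: ennreal_power flip: exp_double) (simp flip: ennreal_mult')
    finally show ?thesis .
  qed
  \<comment> \<open>Every design point has law \<open>\<rho>\<close>, so the mean of
    \<open>Z\<close> involves the curves only through their squared L2 distance.\<close>
  have int1: "integrable (design n m) (\<lambda>t. (f (t ij) - g (t ij))\<^sup>2)"
    "(\<integral>t. (f (t ij) - g (t ij))\<^sup>2 \<partial>design n m) = (\<integral>x. (f x - g x)\<^sup>2 \<partial>\<rho>)" if ij: "ij \<in> ?I" for ij
  proof -
    have d: "distr (design n m) \<rho> (\<lambda>t. t ij) = \<rho>"
      by (rule distr_PiM_component) (auto simp: ij prob_space_axioms)
    have [measurable]: "(\<lambda>t. t ij) \<in> measurable (design n m) \<rho>" using ij by measurable
    show "integrable (design n m) (\<lambda>t. (f (t ij) - g (t ij))\<^sup>2)"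
      using fg by (subst (asm) d[symmetric], subst (asm) integrable_distr_eq) auto
    show "(\<integral>t. (f (t ij) - g (t ij))\<^sup>2 \<partial>design n m) = (\<integral>x. (f x - g x)\<^sup>2 \<partial>\<rho>)"
      by (subst (2) d[symmetric], subst integral_distr) auto
  qed
  have Zint: "integrable (design n m) Z"
    "(\<integral>t. Z t \<partial>design n m) = real (m * n) * (\<integral>x. (f x - g x)\<^sup>2 \<partial>\<rho>) / (4 * \<sigma>\<^sup>2)"
    unfolding Z_def[abs_def] by (auto simp: int1 Bochner_Integration.integral_sum mult.commute)
  have Z0: "0 \<le> Z t" for t unfolding Z_def by (intro divide_nonneg_nonneg sum_nonneg) auto
  have [measurable]: "Z \<in> borel_measurable (design n m)" using Zint(1) by auto
  have expint: "integrable (design n m) (\<lambda>t. exp (- Z t))"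
    by (rule D.P.integrable_const_bound[of _ 1]) (auto simp: Z0)
  \<comment> \<open>The bound \<open>exp (- x) >= 1 - x\<close> lets the average over the design act
    on \<open>Z\<close> itself. Hence no bound on the supremum of \<open>f - g\<close> is
    needed.\<close>
  have "1 - (\<integral>t. Z t \<partial>design n m) = (\<integral>t. 1 - Z t \<partial>design n m)"
    using Zint(1) D.P.prob_space by simp
  also have "\<dots> \<le> (\<integral>t. exp (- Z t) \<partial>design n m)"
  proof (rule integral_mono)
    show "1 - Z t \<le> exp (- Z t)" for t using exp_ge_add_one_self[of "- Z t"] by simp
  qed (use Zint(1) expint in auto)
  finally have "(\<theta>1 - \<theta>0)\<^sup>2 / 2 * (1 - (\<integral>t. Z t \<partial>design n m))
      \<le> (\<theta>1 - \<theta>0)\<^sup>2 / 2 * (\<integral>t. exp (- Z t) \<partial>design n m)"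
    by (intro mult_left_mono) auto
  then have "ennreal ((\<theta>1 - \<theta>0)\<^sup>2 / 2 * (1 - (\<integral>t. Z t \<partial>design n m)))
      \<le> ennreal (\<integral>t. (\<theta>1 - \<theta>0)\<^sup>2 / 2 * exp (- Z t) \<partial>design n m)"
    by (intro ennreal_leI) simp
  also have "\<dots> = (\<integral>\<^sup>+t. ennreal ((\<theta>1 - \<theta>0)\<^sup>2 / 2 * exp (- Z t)) \<partial>design n m)"
    using expint by (intro nn_integral_eq_integral[symmetric]) auto
  also have "\<dots> \<le> (\<integral>\<^sup>+t. E f \<theta>0 t + E g \<theta>1 t \<partial>design n m)"
    by (intro nn_integral_mono point)
  also have "\<dots> = coeff_risk \<sigma> n m T (dirac f) \<theta>0 + coeff_risk \<sigma> n m T (dirac g) \<theta>1"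
    by (simp add: risk nn_integral_add)
  finally show ?thesis by (simp add: Zint)
qed

section \<open>Lower bounds\<close>

abbreviation worst_risk where
  "worst_risk r s R \<sigma> n m est \<equiv> (SUP P\<in>law_class \<rho> lam e r s R. risk \<rho> \<sigma> n m r est P)"

text \<open>With success probability \<open>p\<close> the moment function is \<open>p\<close> times
  a fixed tensor power, so its coefficient along \<open>tensor_basis r 0\<close> is
  \<open>p * a ^ r\<close>. The error of estimating a Bernoulli parameter from \<open>n\<close>
  draws cannot be avoided, whatever the value of \<open>m\<close>.\<close>

lemma minimax_ge_parametric:
  fixes s :: real
  assumes r: "r \<ge> 1" and R: "R > 0" and \<sigma>: "\<sigma> > 0" and n: "n \<ge> 1" and est: "est \<in> estimators n m r"
  defines "a \<equiv> R * lam 0 powr (s / 2)"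
  shows "ennreal (3 * a ^ (2 * r) / 64 / real n) \<le> worst_risk r s R \<sigma> n m est"
proof -
  let ?B = "worst_risk r s R \<sigma> n m est"
  \<comment> \<open>By the choice of \<open>a\<close> this curve lies on the sphere of radius
    \<open>R\<close>. The other atom is the zero curve, written as an empty combination so that
    \<open>comb_Hs\<close> covers it as well.\<close>
  define g where "g = comb {0} (\<lambda>_. a)"
  define z where "z = comb {} (\<lambda>_. a)"
  define F where "F = {z, g}"
  have a: "a > 0" using R lam_pos[of 0] by (simp add: a_def)
  have ge: "(\<integral>x. g x * e 0 x \<partial>\<rho>) = a" unfolding g_def by (simp add: integral_comb)
  have z0: "z x = 0" for x by (simp add: z_def comb_def)
  have zg: "z \<noteq> g" using ge a by (auto simp: z0 dest: sym)
  have F: "finite F" "\<And>f. f \<in> F \<Longrightarrow> f \<in> borel_measurable borel"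
    by (auto simp: F_def g_def z_def)
  have a2: "a\<^sup>2 / lam 0 powr s = R\<^sup>2"
  proof -
    have "(lam 0 powr (s / 2))\<^sup>2 = lam 0 powr s" by (simp add: power2_eq_square flip: powr_add)
    then show ?thesis using lam_pos[of 0] by (simp add: a_def power_mult_distrib)
  qed
  have H: "f \<in> Hs_space \<rho> lam e s" "0 \<le> Hs_norm \<rho> lam e s f \<and> Hs_norm \<rho> lam e s f \<le> R" if "f \<in> F" for f
    using that R by (auto simp: F_def g_def z_def comb_Hs a2)
  define w where "w p f = (if f = g then p else 1 - p)" for p :: real and f :: "'a \<Rightarrow> real"
  have sumF: "(\<Sum>f\<in>F. \<phi> f) = \<phi> z + \<phi> g" for \<phi> :: "('a \<Rightarrow> real) \<Rightarrow> real"
    using zg by (simp add: F_def)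
  have bound: "coeff_risk \<sigma> n m (estimated_coeff r est 0) (atomic_law F (w p)) (p * a ^ r) \<le> ?B"
    and w: "\<And>f. 0 \<le> w p f" "(\<Sum>f\<in>F. w p f) = 1" if p: "0 \<le> p" "p \<le> 1" for p
  proof -
    show w: "\<And>f. 0 \<le> w p f" "(\<Sum>f\<in>F. w p f) = 1"
      using p zg by (auto simp: w_def sumF)
    have mom: "moment_fun r (atomic_law F (w p)) = (\<lambda>u. p * (\<Prod>l<r. g (u l)))"
      using r zg by (auto simp: fun_eq_iff moment_atomic_law[OF F(1) w(1)] sumF z0 w_def)
    have gL: "g \<in> L2_fun \<rho>" by (simp add: g_def comb_L2)
    have coeff: "(\<integral>u. moment_fun r (atomic_law F (w p)) u * tensor_basis r 0 u \<partial>(\<Pi>\<^sub>M l\<in>{..<r}. \<rho>)) = p * a ^ r"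
      using integral_power_tensor_basis[OF r gL, of 0] r
      by (simp add: mom mult.assoc ge power_eq_if)
    have "coeff_risk \<sigma> n m (estimated_coeff r est 0) (atomic_law F (w p)) (p * a ^ r)
        \<le> risk \<rho> \<sigma> n m r est (atomic_law F (w p))"
      using sum_coeff_risk_le_risk[OF r est evaluation_atomic_law[OF F], of "w p" "{0}" \<sigma>]
      using L2_fun_cmult[OF tensor_L2[of r "\<lambda>_. g", OF gL], of p] coeff by (simp add: mom)
    also have "\<dots> \<le> ?B"
      by (rule SUP_upper, rule atomic_law_in_class[OF F w H])
    finally show "coeff_risk \<sigma> n m (estimated_coeff r est 0) (atomic_law F (w p)) (p * a ^ r) \<le> ?B" .
  qed
  \<comment> \<open>At distance \<open>2 * h\<close> between the success probabilities, the squared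
    affinity of one draw is \<open>1 - 4 * h^2 = 1 - 1 / (4 * n)\<close>. By Bernoulli's inequality
    its \<open>n\<close>-th power stays above 3/4.\<close>
  define h where "h = 1 / (4 * sqrt (real n))"
  have sn: "sqrt (real n) \<ge> 1" using n by simp
  have h: "0 < h" "h \<le> 1 / 4" using sn by (auto simp: h_def field_simps)
  have h2: "h\<^sup>2 = 1 / (16 * real n)" using n by (simp add: h_def power_divide power_mult_distrib)
  have p0: "0 \<le> 1 / 2 - h" "1 / 2 - h \<le> 1" and p1: "0 \<le> 1 / 2 + h" "1 / 2 + h \<le> 1" using h by auto
  have "(\<Sum>f\<in>F. sqrt (w (1/2 - h) f * w (1/2 + h) f)) = 2 * sqrt (1 / 4 - h\<^sup>2)"
    using zg by (simp add: sumF w_def algebra_simps power2_eq_square)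
  moreover have "(2 * sqrt (1 / 4 - h\<^sup>2))\<^sup>2 = 1 - 1 / (4 * real n)"
    using h n by (simp add: power_mult_distrib h2)
  ultimately have aff: "(\<Sum>f\<in>F. sqrt (w (1/2 - h) f * w (1/2 + h) f)) ^ (2 * n) = (1 - 1 / (4 * real n)) ^ n"
    by (simp only: power_mult)
  have "3 / 4 = 1 + real n * (- 1 / (4 * real n))" using n by simp
  also have "\<dots> \<le> (1 + - 1 / (4 * real n)) ^ n"
    using n by (intro Bernoulli_inequality) (simp add: field_simps)
  finally have B: "3 / 4 \<le> (1 - 1 / (4 * real n)) ^ n" by simp
  have \<Delta>: "((1/2 + h) * a ^ r - (1/2 - h) * a ^ r)\<^sup>2 / 2 = a ^ (2 * r) / (8 * real n)"
  proof -
    have "((1/2 + h) * a ^ r - (1/2 - h) * a ^ r)\<^sup>2 = 4 * h\<^sup>2 * (a ^ r)\<^sup>2"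
      by (simp add: algebra_simps power2_eq_square)
    then show ?thesis by (simp add: h2 power_mult mult.commute flip: power_mult)
  qed
  have "2 * ennreal (3 * a ^ (2 * r) / 64 / real n) = ennreal (a ^ (2 * r) / (8 * real n) * (3 / 4))"
    using a by (simp flip: ennreal_numeral ennreal_mult)
  also have "\<dots> \<le> ennreal (a ^ (2 * r) / (8 * real n) * (1 - 1 / (4 * real n)) ^ n)"
    using a by (intro ennreal_leI mult_left_mono B) auto
  also have "\<dots> \<le> coeff_risk \<sigma> n m (estimated_coeff r est 0) (atomic_law F (w (1/2 - h))) ((1/2 - h) * a ^ r)
      + coeff_risk \<sigma> n m (estimated_coeff r est 0) (atomic_law F (w (1/2 + h))) ((1/2 + h) * a ^ r)"
    using two_point_atomic_law[OF \<sigma> F w[OF p0] w[OF p1] estimated_coeff_measurable[OF est],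
        of "(1/2 + h) * a ^ r" "(1/2 - h) * a ^ r"]
    unfolding \<Delta> aff .
  also have "\<dots> \<le> ?B + ?B" by (intro add_mono bound p0 p1)
  also have "\<dots> = 2 * ?B" by (simp add: mult_2)
  finally show ?thesis by (subst (asm) ennreal_mult_le_mult_iff) auto
qed

text \<open>Assouad's lemma on a cube of deterministic curves. The assumption \<open>ball\<close>
  puts all vertices into the class, and the assumption on \<open>\<delta>\<close> keeps the
  endpoints of every edge hard to distinguish.\<close>

lemma minimax_ge_hypercube:
  assumes r: "r \<ge> 1" and R: "R > 0" and \<sigma>: "\<sigma> > 0" and est: "est \<in> estimators n m r"
    and J: "J \<ge> 1" and \<delta>: "real (m * n) * \<delta>\<^sup>2 \<le> 2 * \<sigma>\<^sup>2"
    and ball: "a\<^sup>2 / lam 0 powr s + (\<Sum>j\<in>{J..<2*J}. \<delta>\<^sup>2 / lam j powr s) \<le> R\<^sup>2"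
  shows "ennreal (real J * (\<delta>\<^sup>2 * a ^ (2 * (r - 1))) / 8) \<le> worst_risk r s R \<sigma> n m est"
proof -
  let ?B = "worst_risk r s R \<sigma> n m est"
  \<comment> \<open>These are \<open>J\<close> directions with indices of order \<open>J\<close>; as
    \<open>J >= 1\<close>, index 0 stays free for the common component \<open>a\<close>.\<close>
  define S where "S = {J..<2*J}"
  define b where "b j = (if j = 0 then a else \<delta>)" for j :: nat
  define f where "f A = comb (insert 0 A) b" for A
  define \<theta> where "\<theta> = \<delta> * a ^ (r - 1)"
  define E where "E A j = coeff_risk \<sigma> n m (estimated_coeff r est j) (dirac (f A)) (if j \<in> A then \<theta> else 0)" for A j
  have S: "finite S" "card S = J" "0 \<notin> S" using J by (auto simp: S_def)
  have f_meas: "f A \<in> borel_measurable borel" for A by (simp add: f_def)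
  have fL: "f A \<in> L2_fun \<rho>" for A by (simp add: f_def comb_L2)
  have upper: "(\<Sum>j\<in>S. E A j) \<le> ?B" if A: "A \<subseteq> S" for A
  proof -
    have finA: "finite A" and 0: "0 \<notin> A" using A S finite_subset by auto
    have mom: "moment_fun r (dirac (f A)) = (\<lambda>u. \<Prod>l<r. f A (u l))"
      by (rule ext) (simp add: moment_atomic_law)
    have coeff: "(\<integral>u. moment_fun r (dirac (f A)) u * tensor_basis r j u \<partial>(\<Pi>\<^sub>M l\<in>{..<r}. \<rho>))
        = (if j \<in> A then \<theta> else 0)" if "j \<in> S" for j
      using that 0 S(3) unfolding mom integral_power_tensor_basis[OF r fL]
      by (auto simp: f_def integral_comb finA b_def \<theta>_def)
    have ev: "(\<lambda>(f, x). f x) \<in> borel_measurable (dirac (f A) \<Otimes>\<^sub>M \<rho>)"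
      by (rule evaluation_atomic_law) (auto simp: f_meas)
    have "(\<Sum>j\<in>S. E A j) = (\<Sum>j\<in>S. coeff_risk \<sigma> n m (estimated_coeff r est j) (dirac (f A))
        (\<integral>u. moment_fun r (dirac (f A)) u * tensor_basis r j u \<partial>(\<Pi>\<^sub>M l\<in>{..<r}. \<rho>)))"
      by (intro sum.cong refl) (simp add: E_def coeff)
    also have "\<dots> \<le> risk \<rho> \<sigma> n m r est (dirac (f A))"
      by (rule sum_coeff_risk_le_risk[OF r est ev _ S(1)])
        (unfold mom, rule tensor_L2[of r "\<lambda>_. f A", OF fL])
    also have "\<dots> \<le> ?B"
    proof (rule SUP_upper, rule atomic_law_in_class)
      have "(\<Sum>j\<in>insert 0 A. (b j)\<^sup>2 / lam j powr s) = a\<^sup>2 / lam 0 powr s + (\<Sum>j\<in>A. \<delta>\<^sup>2 / lam j powr s)"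
        using 0 finA by (auto simp: b_def intro!: sum.cong)
      also have "(\<Sum>j\<in>A. \<delta>\<^sup>2 / lam j powr s) \<le> (\<Sum>j\<in>S. \<delta>\<^sup>2 / lam j powr s)"
        by (rule sum_mono2[OF S(1) A]) auto
      finally have "(\<Sum>j\<in>insert 0 A. (b j)\<^sup>2 / lam j powr s) \<le> R\<^sup>2"
        using ball by (simp add: S_def)
      moreover have "0 \<le> (\<Sum>j\<in>insert 0 A. (b j)\<^sup>2 / lam j powr s)" by (intro sum_nonneg) auto
      ultimately have "0 \<le> Hs_norm \<rho> lam e s (f A) \<and> Hs_norm \<rho> lam e s (f A) \<le> R"
        using R finA unfolding f_def by (simp only: comb_Hs finite_insert) (simp add: real_le_lsqrt)
      then show "0 \<le> Hs_norm \<rho> lam e s h \<and> Hs_norm \<rho> lam e s h \<le> R" if "h \<in> {f A}" for h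
        using that by simp
    qed (auto simp: f_meas, simp add: f_def comb_Hs finA)
    finally show ?thesis .
  qed
  have edge: "ennreal (\<theta>\<^sup>2 / 4) \<le> E A j + E (insert j A) j" if j: "j \<in> S" and A: "A \<subseteq> S - {j}" for A j
  proof -
    have finA: "finite A" using A S(1) by (meson finite_Diff finite_subset)
    have j0: "j \<noteq> 0" "j \<notin> A" using A S(3) j by (metis, auto)
    \<comment> \<open>An edge of the cube changes the curve by exactly
      \<open>\<delta> * e j\<close>, so its squared L2 length is \<open>\<delta>^2\<close> however
      large \<open>e j\<close> is pointwise.\<close>
    have "f (insert j A) x = \<delta> * e j x + f A x" for x
      using j0 finA unfolding f_def comb_def
      by (subst insert_commute, subst sum.insert) (auto simp: b_def)
    then have diff: "(f A x - f (insert j A) x)\<^sup>2 = \<delta>\<^sup>2 * (e j x * e j x)" for x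
      by (simp add: power2_eq_square)
    \<comment> \<open>One factor 1/2 comes from the two-point inequality; the other bounds the
      affinity factor from below, as \<open>m * n * \<delta>^2 / (4 * \<sigma>^2)\<close> is at most
      1/2.\<close>
    have "ennreal (\<theta>\<^sup>2 / 4) \<le> ennreal ((\<theta> - 0)\<^sup>2 / 2 * (1 - real (m * n) * \<delta>\<^sup>2 / (4 * \<sigma>\<^sup>2)))"
    proof (rule ennreal_leI)
      have "real (m * n) * \<delta>\<^sup>2 / (4 * \<sigma>\<^sup>2) \<le> 1 / 2" using \<delta> \<sigma> by (simp add: field_simps)
      then have "\<theta>\<^sup>2 / 2 * (1 / 2) \<le> \<theta>\<^sup>2 / 2 * (1 - real (m * n) * \<delta>\<^sup>2 / (4 * \<sigma>\<^sup>2))"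
        by (intro mult_left_mono) auto
      then show "\<theta>\<^sup>2 / 4 \<le> (\<theta> - 0)\<^sup>2 / 2 * (1 - real (m * n) * \<delta>\<^sup>2 / (4 * \<sigma>\<^sup>2))" by simp
    qed
    also have "\<dots> = ennreal ((\<theta> - 0)\<^sup>2 / 2 * (1 - real (m * n) * (\<integral>x. (f A x - f (insert j A) x)\<^sup>2 \<partial>\<rho>) / (4 * \<sigma>\<^sup>2)))"
      by (simp add: diff on)
    also have "\<dots> \<le> E A j + E (insert j A) j"
      unfolding E_def using j0
      by (simp only: if_False if_True insert_iff simp_thms)
         (rule two_point_dirac[OF \<sigma> f_meas f_meas _ estimated_coeff_measurable[OF est]],
          simp add: diff L2_fun_mult_integrable e_L2)
    finally show ?thesis .
  qed
  have "2 * ennreal (real J * (\<delta>\<^sup>2 * a ^ (2 * (r - 1))) / 8) = ennreal (real J * (\<theta>\<^sup>2 / 4))"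
  proof -
    have "\<theta>\<^sup>2 = \<delta>\<^sup>2 * a ^ (2 * (r - 1))"
      by (simp add: \<theta>_def power_mult_distrib mult.commute flip: power_mult)
    moreover have "2 * ennreal x = ennreal (2 * x)" if "0 \<le> x" for x
      using that by (simp add: ennreal_mult)
    ultimately show ?thesis by (simp del: power_mult_distrib)
  qed
  also have "\<dots> = of_nat (card S) * ennreal (\<theta>\<^sup>2 / 4)"
    by (simp add: S ennreal_of_nat_eq_real_of_nat flip: ennreal_mult')
  also have "\<dots> \<le> 2 * ?B"
    by (rule assouad[OF S(1) upper edge])
  finally show ?thesis by (subst (asm) ennreal_mult_le_mult_iff) auto
qed

text \<open>Put \<open>N = m * n\<close> and \<open>\<gamma> = s * \<beta>\<close>. The eigenvalue
  bound makes direction \<open>j\<close> cost at most order \<open>j^\<gamma>\<close> per unit of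
  squared amplitude. With \<open>\<delta>^2\<close> of order \<open>1 / N\<close>, the
  \<open>J\<close> directions cost order \<open>J^(\<gamma> + 1) / N\<close>, which allows
  \<open>J\<close> of order \<open>N^(1 / (\<gamma> + 1))\<close>. The loss is then of order
  \<open>J / N\<close>.\<close>

lemma minimax_ge_nonparametric:
  assumes r: "r \<ge> 1" and R: "R > 0" and \<sigma>: "\<sigma> > 0" and s: "s > 0" and \<beta>: "\<beta> > 0" and ce: "c_eig > 0"
    and lam_ge: "\<And>j. c_eig * real (Suc j) powr (- \<beta>) \<le> lam j"
  shows "\<exists>c>0. \<forall>n m est. n \<ge> 1 \<longrightarrow> m \<ge> 1 \<longrightarrow> est \<in> estimators n m r \<longrightarrow>
    ennreal (c * real (m * n) powr (- (s * \<beta>) / (s * \<beta> + 1))) \<le> worst_risk r s R \<sigma> n m est"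
proof -
  define \<gamma> where "\<gamma> = s * \<beta>"
  define q where "q = 1 / (\<gamma> + 1)"
  \<comment> \<open>\<open>K * N\<close> will bound the sum of \<open>1 / lam j powr s\<close> over
    the cube directions; 4 is the product of \<open>j < 2 * J\<close> and
    \<open>J <= 2 * N powr q\<close>.\<close>
  define K where "K = c_eig powr (- s) * 4 powr (\<gamma> + 1)"
  \<comment> \<open>The first entry makes the edges hard to detect, the second limits the cube to
    half of the squared radius.\<close>
  define \<tau> where "\<tau> = min (2 * \<sigma>\<^sup>2) (R\<^sup>2 / (2 * K))"
  \<comment> \<open>The common component uses the other half of the squared radius
    \<open>R^2\<close>.\<close>
  define a where "a = R / sqrt 2 * lam 0 powr (s / 2)"
  define c where "c = \<tau> * a ^ (2 * (r - 1)) / 8"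
  have \<gamma>: "\<gamma> > 0" using s \<beta> by (simp add: \<gamma>_def)
  have q: "q > 0" "q * (\<gamma> + 1) = 1" using \<gamma> by (auto simp: q_def)
  have K: "K > 0" using ce by (simp add: K_def)
  have \<tau>: "\<tau> > 0" using \<sigma> R K by (simp add: \<tau>_def)
  have a: "a > 0" using R lam_pos[of 0] by (simp add: a_def)
  have a2: "a\<^sup>2 / lam 0 powr s = R\<^sup>2 / 2"
  proof -
    have "(lam 0 powr (s / 2))\<^sup>2 = lam 0 powr s" by (simp add: power2_eq_square flip: powr_add)
    then show ?thesis using lam_pos[of 0] by (simp add: a_def power_mult_distrib power_divide)
  qed
  have "c > 0" using \<tau> a by (simp add: c_def)
  moreover have "ennreal (c * real (m * n) powr (- \<gamma> / (\<gamma> + 1))) \<le> worst_risk r s R \<sigma> n m est"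
    if n: "n \<ge> 1" and m: "m \<ge> 1" and est: "est \<in> estimators n m r" for n m est
  proof -
    define N where "N = real (m * n)"
    have "m * n \<ge> 1" using n m by simp
    then have N: "N \<ge> 1" unfolding N_def by (metis of_nat_1 of_nat_le_iff)
    define J where "J = nat \<lceil>N powr q\<rceil>"
    define \<delta> where "\<delta> = sqrt (\<tau> / N)"
    have \<delta>2: "\<delta>\<^sup>2 = \<tau> / N" using \<tau> N by (simp add: \<delta>_def)
    have Nq: "N powr q \<ge> 1" using N q by (simp add: ge_one_powr_ge_zero)
    have J_ge: "N powr q \<le> real J" by (simp add: J_def real_nat_ceiling_ge)
    have J1: "J \<ge> 1" using J_ge Nq by linarith
    have "real J = of_int \<lceil>N powr q\<rceil>" using Nq by (simp add: J_def)
    then have J_le: "real J \<le> 2 * N powr q" using Nq by linarith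
    \<comment> \<open>As \<open>lam j\<close> is the eigenvalue number \<open>j + 1\<close>, the
      condition \<open>j < 2 * J\<close> is exactly \<open>Suc j <= 2 * J\<close>.\<close>
    have inv: "1 / lam j powr s \<le> c_eig powr (- s) * real (2 * J) powr \<gamma>" if j: "j < 2 * J" for j
    proof -
      have "c_eig * real (2 * J) powr (- \<beta>) \<le> c_eig * real (Suc j) powr (- \<beta>)"
        using j \<beta> ce by (intro mult_left_mono powr_mono2') auto
      also have "\<dots> \<le> lam j" by (rule lam_ge)
      finally have "(c_eig * real (2 * J) powr (- \<beta>)) powr s \<le> lam j powr s"
        using s ce by (intro powr_mono2) auto
      moreover have "0 < (c_eig * real (2 * J) powr (- \<beta>)) powr s" using ce J1 by simp
      ultimately have "1 / lam j powr s \<le> 1 / (c_eig * real (2 * J) powr (- \<beta>)) powr s"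
        by (intro divide_left_mono) (auto intro!: mult_pos_pos)
      also have "\<dots> = c_eig powr (- s) * real (2 * J) powr \<gamma>"
      proof -
        have "(c_eig * x powr (- \<beta>)) powr s = 1 / (c_eig powr (- s) * x powr \<gamma>)" if "x > 0" for x
          using ce that by (simp add: powr_mult powr_powr powr_divide powr_minus_divide \<gamma>_def mult.commute)
        from this[of "real (2 * J)"] show ?thesis using J1 by simp
      qed
      finally show ?thesis .
    qed
    have "(\<Sum>j\<in>{J..<2*J}. 1 / lam j powr s) \<le> (\<Sum>j\<in>{J..<2*J}. c_eig powr (- s) * real (2 * J) powr \<gamma>)"
      by (intro sum_mono inv) auto
    also have "\<dots> = c_eig powr (- s) * (real J * real (2 * J) powr \<gamma>)" by simp
    also have "\<dots> \<le> c_eig powr (- s) * (real (2 * J) powr \<gamma> * real (2 * J))"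
      by (intro mult_left_mono) (auto simp: mult.commute intro!: mult_right_mono)
    also have "\<dots> = c_eig powr (- s) * real (2 * J) powr (\<gamma> + 1)"
      using J1 by (simp add: powr_add)
    also have "\<dots> \<le> c_eig powr (- s) * (4 * N powr q) powr (\<gamma> + 1)"
      using J_le \<gamma> by (intro mult_left_mono powr_mono2) auto
    also have "\<dots> = K * N"
      using N by (simp add: K_def powr_mult powr_powr q)
    finally have "\<delta>\<^sup>2 * (\<Sum>j\<in>{J..<2*J}. 1 / lam j powr s) \<le> \<delta>\<^sup>2 * (K * N)"
      by (intro mult_left_mono) auto
    also have "\<dots> = \<tau> * K" using N by (simp add: \<delta>2)
    also have "\<dots> \<le> R\<^sup>2 / (2 * K) * K" using K by (intro mult_right_mono) (auto simp: \<tau>_def)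
    also have "\<dots> = R\<^sup>2 / 2" using K by simp
    finally have ball: "a\<^sup>2 / lam 0 powr s + (\<Sum>j\<in>{J..<2*J}. \<delta>\<^sup>2 / lam j powr s) \<le> R\<^sup>2"
      by (simp add: a2 sum_distrib_left)
    have noise: "real (m * n) * \<delta>\<^sup>2 \<le> 2 * \<sigma>\<^sup>2"
      unfolding N_def[symmetric] using N by (simp add: \<delta>2 \<tau>_def)
    have "c * N powr (- \<gamma> / (\<gamma> + 1)) = N powr q * (\<tau> / N * a ^ (2 * (r - 1))) / 8"
    proof -
      \<comment> \<open>The rate is \<open>N powr q\<close> directions times a squared amplitude of
        order \<open>1 / N\<close>.\<close>
      have "- \<gamma> / (\<gamma> + 1) = q - 1" using \<gamma> by (simp add: q_def field_simps)
      then have "N powr (- \<gamma> / (\<gamma> + 1)) = N powr q / N" using N by (simp add: powr_diff)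
      then show ?thesis by (simp add: c_def mult_ac)
    qed
    also have "\<dots> \<le> real J * (\<delta>\<^sup>2 * a ^ (2 * (r - 1))) / 8"
      unfolding \<delta>2 using J_ge \<tau> N a by (intro divide_right_mono mult_right_mono) auto
    finally have "ennreal (c * N powr (- \<gamma> / (\<gamma> + 1))) \<le> ennreal (real J * (\<delta>\<^sup>2 * a ^ (2 * (r - 1))) / 8)"
      by (rule ennreal_leI)
    also have "\<dots> \<le> worst_risk r s R \<sigma> n m est"
      by (rule minimax_ge_hypercube[OF r R \<sigma> est J1 noise ball])
    finally show ?thesis by (simp add: N_def)
  qed
  ultimately show ?thesis unfolding \<gamma>_def by blast
qed

end

theorem theorem4:
  fixes \<rho> :: "('a::metric_space) measure"
    and k :: "'a \<Rightarrow> 'a \<Rightarrow> real"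
    and lam :: "nat \<Rightarrow> real"
    and e :: "nat \<Rightarrow> 'a \<Rightarrow> real"
    and \<beta> c_eig C_eig s R \<sigma> :: real
    and r :: nat
  assumes "compact (UNIV :: 'a set)"
    and "prob_space \<rho>" and "sets \<rho> = sets borel"
    and "continuous_pd_kernel k"
    and "eigensystem \<rho> k lam e"
    and "\<beta> > 1"
    and "0 < c_eig" and "c_eig \<le> C_eig"
    and "\<And>j. c_eig * real (Suc j) powr (- \<beta>) \<le> lam j"
    and "\<And>j. lam j \<le> C_eig * real (Suc j) powr (- \<beta>)"
    and "r \<ge> 1" and "s > 1 / \<beta>" and "R > 0" and "\<sigma> > 0"
  shows "\<exists>c>0. \<forall>\<^sub>F n in sequentially. \<forall>m\<ge>r.
    (INF est\<in>estimators n m r. SUP P\<in>law_class \<rho> lam e r s R. risk \<rho> \<sigma> n m r est P)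
      \<ge> ennreal (c * (1 / real n + real (m * n) powr (- (s * \<beta>) / (s * \<beta> + 1))))"
proof -
  interpret orthonormal_system \<rho> e lam
    using assms(2,3,5) by (auto simp: orthonormal_system_def orthonormal_system_axioms_def eigensystem_def)
  have \<beta>: "\<beta> > 0" using assms(6) by simp
  have s: "s > 0" using assms(12) \<beta> by (meson divide_pos_pos less_trans zero_less_one)
  obtain c2 where c2: "c2 > 0" and nonpar: "\<And>n m est. n \<ge> 1 \<Longrightarrow> m \<ge> 1 \<Longrightarrow> est \<in> estimators n m r \<Longrightarrow>
      ennreal (c2 * real (m * n) powr (- (s * \<beta>) / (s * \<beta> + 1))) \<le> worst_risk r s R \<sigma> n m est"
    using minimax_ge_nonparametric[OF assms(11,13,14) s \<beta> assms(7,9)] by auto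
  define c1 where "c1 = 3 * (R * lam 0 powr (s / 2)) ^ (2 * r) / 64"
  have c1: "c1 > 0" using assms(13) lam_pos[of 0] by (simp add: c1_def)
  \<comment> \<open>Half of the smaller constant: \<open>c * (x + y)\<close> is then at most the
    mean of \<open>c1 * x\<close> and \<open>c2 * y\<close>, hence at most their maximum. It works
    for all \<open>n >= 1\<close>; \<open>m >= r >= 1\<close> makes the nonparametric bound
    applicable.\<close>
  define c where "c = min c1 c2 / 2"
  have "ennreal (c * (1 / real n + real (m * n) powr (- (s * \<beta>) / (s * \<beta> + 1))))
      \<le> (INF est\<in>estimators n m r. worst_risk r s R \<sigma> n m est)" if n: "n \<ge> 1" and m: "m \<ge> r" for n m
  proof (rule INF_greatest)
    fix est :: "(nat \<times> nat \<Rightarrow> 'a \<times> real) \<Rightarrow> (nat \<Rightarrow> 'a) \<Rightarrow> real"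
    assume est: "est \<in> estimators n m r"
    let ?x = "1 / real n" and ?y = "real (m * n) powr (- (s * \<beta>) / (s * \<beta> + 1))"
    have "c * ?x \<le> c1 / 2 * ?x" "c * ?y \<le> c2 / 2 * ?y"
      unfolding c_def by (intro mult_right_mono; simp)+
    then have "c * (?x + ?y) \<le> max (c1 * ?x) (c2 * ?y)"
      unfolding distrib_left by linarith
    then have "ennreal (c * (?x + ?y)) \<le> ennreal (max (c1 * ?x) (c2 * ?y))" by (rule ennreal_leI)
    also have "\<dots> \<le> worst_risk r s R \<sigma> n m est"
    proof (cases "c1 * ?x \<le> c2 * ?y")
      case True
      then show ?thesis using nonpar[OF n _ est] m assms(11) by (simp only: max_absorb2)
    next
      case False
      then show ?thesis using minimax_ge_parametric[OF assms(11,13,14) n est, of s]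
        by (simp add: max_def c1_def)
    qed
    finally show "ennreal (c * (?x + ?y)) \<le> worst_risk r s R \<sigma> n m est" .
  qed
  moreover have "c > 0" using c1 c2 by (simp add: c_def)
  ultimately show ?thesis
    by (intro exI[of _ c] conjI eventually_sequentiallyI[of 1] allI impI)
qed

end
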